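(* Let $\mathcal X$ be a set of variables of arbitrary infinite (possibly uncountable) cardinality $\kappa$, let $\Theta\subseteq\mathsf{FORM}_{\mathcal X}$ and $\psi\in\mathsf{FORM}_{\mathcal X}$. Then $\Theta\models_\partial\psi$ if and only if $\Theta\vdash\psi$.
   Context: $\mathsf{FORM}_{\mathcal X}$ is the set of formulas of infinite-valued Łukasiewicz propositional logic whose (finitely many) variables lie in $\mathcal X$; $\Theta\vdash\psi$ means derivability from $\Theta$ via the Łukasiewicz axioms and Modus Ponens. For a finite $\mathcal H\subseteq\mathcal X$ and a formula $\phi$ with variables in $\mathcal H$, $\hat\phi\colon[0,1]^{\mathcal H}\to[0,1]$ is its truth function (computed with $\neg x=1-x$, $x\oplus y=\min(1,x+y)$); $\mathcal M([0,1]^{\mathcal H})$ denotes the MV-algebra of all such functions (the free MV-algebra on $\mathcal H$), and for $\mathcal H\subseteq\mathcal K$ it is identified with a subalgebra of $\mathcal M([0,1]^{\mathcal K})$ (functions not depending on coordinates outside $\mathcal H$). $\mathrm{var}(\phi)$ is the set of variables occurring in $\phi$. A differential valuation in $\mathbb R^{\mathcal H}$ (with $|\mathcal H|=h$) is, for some $0\le t\le h$, a tuple $U=(u_0,\dots,u_t)$ of vectors in $\mathbb R^{\mathcal H}$ with $u_1,\dots,u_t$ pairwise orthogonal unit vectors, such that for all large integers $m$ the simplex $T_{U,m}=\mathrm{conv}(u_0,\,u_0+u_1/m,\dots,u_0+u_1/m+\cdots+u_t/m^t)$ lies in $[0,1]^{\mathcal H}$; $\mathfrak p_U=\{f\in\mathcal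 M([0,1]^{\mathcal H})\mid f \text{ vanishes on } T_{U,m}\text{ for some } m\}$. For finite $\mathcal H\subseteq\mathcal K\subseteq\mathcal X$ and differential valuations $U$ in $\mathbb R^{\mathcal H}$, $V$ in $\mathbb R^{\mathcal K}$, $V$ dominates $U$ ($V\succeq U$) if $\mathfrak p_U=\mathfrak p_V\cap\mathcal M([0,1]^{\mathcal H})$. A differential valuation in $\mathbb R^\kappa$ is a family $W=\{U_{\mathcal H}\}$, indexed by all finite $\mathcal H\subseteq\mathcal X$, of differential valuations $U_{\mathcal H}$ in $\mathbb R^{\mathcal H}$ such that for all finite $\mathcal H',\mathcal H''$, $U_{\mathcal H'\cup\mathcal H''}$ dominates both $U_{\mathcal H'}$ and $U_{\mathcal H''}$. $W$ satisfies $\phi$ if $1-\hat\phi\in\mathfrak p_{U_{\mathrm{var}(\phi)}}$. $\Theta\models_\partial\psi$ iff every differential valuation in $\mathbb R^\kappa$ satisfying every $\theta\in\Theta$ satisfies $\psi$. *)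

theory Defs
  imports "HOL-Library.FuncSet" "HOL-Analysis.L2_Norm"
begin

text \<open>
  Formulas are built from \<open>\<not>\<close> and \<open>\<rightarrow>\<close>, the connectives in which the Lukasiewicz axioms are
  stated; \<open>\<phi> \<oplus> \<psi>\<close> stands for \<open>\<not>\<phi> \<rightarrow> \<psi>\<close>.
\<close>

datatype (vars: 'x) luk_form =
    Var 'x
  | Neg "'x luk_form"
  | Imp "'x luk_form" "'x luk_form"

definition Oplus :: "'x luk_form \<Rightarrow> 'x luk_form \<Rightarrow> 'x luk_form" where
  "Oplus \<phi> \<psi> = Imp (Neg \<phi>) \<psi>"

definition FORM :: "'x set \<Rightarrow> 'x luk_form set" where
  "FORM X = {\<phi>. vars \<phi> \<subseteq> X}"

inductive luk_axiom :: "'x luk_form \<Rightarrow> bool" where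
  A1: "luk_axiom (Imp \<phi> (Imp \<psi> \<phi>))"
| A2: "luk_axiom (Imp (Imp \<phi> \<psi>) (Imp (Imp \<psi> \<chi>) (Imp \<phi> \<chi>)))"
| A3: "luk_axiom (Imp (Imp (Imp \<phi> \<psi>) \<psi>) (Imp (Imp \<psi> \<phi>) \<phi>))"
| A4: "luk_axiom (Imp (Imp (Neg \<phi>) (Neg \<psi>)) (Imp \<psi> \<phi>))"

inductive luk_derives :: "'x set \<Rightarrow> 'x luk_form set \<Rightarrow> 'x luk_form \<Rightarrow> bool"
  for X :: "'x set" and \<Theta> :: "'x luk_form set" where
  hyp: "\<theta> \<in> \<Theta> \<Longrightarrow> luk_derives X \<Theta> \<theta>"
| ax: "luk_axiom \<phi> \<Longrightarrow> \<phi> \<in> FORM X \<Longrightarrow> luk_derives X \<Theta> \<phi>"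
| mp: "luk_derives X \<Theta> \<phi> \<Longrightarrow> luk_derives X \<Theta> (Imp \<phi> \<psi>) \<Longrightarrow> luk_derives X \<Theta> \<psi>"

definition mv_neg :: "real \<Rightarrow> real" where
  "mv_neg x = 1 - x"

definition mv_oplus :: "real \<Rightarrow> real \<Rightarrow> real" where
  "mv_oplus x y = min 1 (x + y)"

primrec luk_eval :: "('x \<Rightarrow> real) \<Rightarrow> 'x luk_form \<Rightarrow> real" where
  "luk_eval v (Var x) = v x"
| "luk_eval v (Neg \<phi>) = mv_neg (luk_eval v \<phi>)"
| "luk_eval v (Imp \<phi> \<psi>) = mv_oplus (mv_neg (luk_eval v \<phi>)) (luk_eval v \<psi>)"

lemma luk_eval_Oplus: "luk_eval v (Oplus \<phi> \<psi>) = mv_oplus (luk_eval v \<phi>) (luk_eval v \<psi>)"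
  by (simp add: Oplus_def mv_neg_def)

text \<open>
  \<open>\<real>\<^sup>H\<close> is \<open>H \<rightarrow>\<^sub>E UNIV\<close>, the functions with value \<open>undefined\<close> outside \<open>H\<close>; likewise a function on
  the cube is \<open>undefined\<close> outside the cube.
\<close>

definition cube :: "'x set \<Rightarrow> ('x \<Rightarrow> real) set" where
  "cube H = H \<rightarrow>\<^sub>E {0..1}"

definition truth_fun :: "'x set \<Rightarrow> 'x luk_form \<Rightarrow> ('x \<Rightarrow> real) \<Rightarrow> real" where
  "truth_fun H \<phi> = (\<lambda>v\<in>cube H. luk_eval v \<phi>)"

definition McN :: "'x set \<Rightarrow> (('x \<Rightarrow> real) \<Rightarrow> real) set" where
  "McN H = {truth_fun H \<phi> | \<phi>. vars \<phi> \<subseteq> H}"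

text \<open>For \<open>H \<subseteq> K\<close>, this embeds \<open>McN H\<close> into \<open>McN K\<close> as the functions independent of \<open>K - H\<close>.\<close>

definition McN_embed ::
    "'x set \<Rightarrow> 'x set \<Rightarrow> (('x \<Rightarrow> real) \<Rightarrow> real) \<Rightarrow> (('x \<Rightarrow> real) \<Rightarrow> real)" where
  "McN_embed H K f = (\<lambda>v\<in>cube K. f (restrict v H))"

text \<open>
  A tuple \<open>(u\<^sub>0, \<dots>, u\<^sub>t)\<close> is a list \<open>U\<close> of length \<open>t + 1\<close>. For \<open>m > 0\<close>, \<open>dv_simplex H U m\<close> is the
  convex hull of the points \<open>dv_vertex H U m 0, \<dots>, dv_vertex H U m t\<close>.
\<close>

definition dv_vertex :: "'x set \<Rightarrow> ('x \<Rightarrow> real) list \<Rightarrow> nat \<Rightarrow> nat \<Rightarrow> ('x \<Rightarrow> real)" where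
  "dv_vertex H U m i = (\<lambda>x\<in>H. \<Sum>j\<le>i. (U ! j) x / real m ^ j)"

definition dv_simplex :: "'x set \<Rightarrow> ('x \<Rightarrow> real) list \<Rightarrow> nat \<Rightarrow> ('x \<Rightarrow> real) set" where
  "dv_simplex H U m =
     {(\<lambda>x\<in>H. \<Sum>i<length U. c i * dv_vertex H U m i x) | c :: nat \<Rightarrow> real.
        (\<forall>i<length U. c i \<ge> 0) \<and> (\<Sum>i<length U. c i) = 1}"

definition is_diff_val :: "'x set \<Rightarrow> ('x \<Rightarrow> real) list \<Rightarrow> bool" where
  "is_diff_val H U \<longleftrightarrow>
     U \<noteq> [] \<and> length U - 1 \<le> card H \<and> set U \<subseteq> (H \<rightarrow>\<^sub>E UNIV) \<and>
     (\<forall>i\<in>{1..<length U}. L2_set (U ! i) H = 1) \<and>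
     (\<forall>i\<in>{1..<length U}. \<forall>j\<in>{1..<length U}.
        i \<noteq> j \<longrightarrow> (\<Sum>x\<in>H. (U ! i) x * (U ! j) x) = 0) \<and>
     (\<forall>\<^sub>F m in sequentially. dv_simplex H U m \<subseteq> cube H)"

text \<open>
  Only those \<open>m\<close> are meaningful for which the simplex lies in the cube, the domain of \<open>f\<close>.
\<close>

definition dv_ideal :: "'x set \<Rightarrow> ('x \<Rightarrow> real) list \<Rightarrow> (('x \<Rightarrow> real) \<Rightarrow> real) set" where
  "dv_ideal H U =
     {f \<in> McN H. \<exists>m>0. dv_simplex H U m \<subseteq> cube H \<and> (\<forall>v\<in>dv_simplex H U m. f v = 0)}"

text \<open>\<open>V\<close> in \<open>\<real>\<^sup>K\<close> dominates \<open>U\<close> in \<open>\<real>\<^sup>H\<close>.\<close>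

definition dominates ::
    "'x set \<Rightarrow> ('x \<Rightarrow> real) list \<Rightarrow> 'x set \<Rightarrow> ('x \<Rightarrow> real) list \<Rightarrow> bool" where
  "dominates K V H U \<longleftrightarrow>
     McN_embed H K ` dv_ideal H U = dv_ideal K V \<inter> McN_embed H K ` McN H"

text \<open>A differential valuation in \<open>\<real>\<^sup>X\<close>; the values of \<open>W\<close> at other sets are irrelevant.\<close>

definition is_diff_val_family :: "'x set \<Rightarrow> ('x set \<Rightarrow> ('x \<Rightarrow> real) list) \<Rightarrow> bool" where
  "is_diff_val_family X W \<longleftrightarrow>
     (\<forall>H. finite H \<and> H \<subseteq> X \<longrightarrow> is_diff_val H (W H)) \<and>
     (\<forall>H H'. finite H \<and> H \<subseteq> X \<and> finite H' \<and> H' \<subseteq> X \<longrightarrow>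
        dominates (H \<union> H') (W (H \<union> H')) H (W H) \<and>
        dominates (H \<union> H') (W (H \<union> H')) H' (W H'))"

definition dv_satisfies :: "('x set \<Rightarrow> ('x \<Rightarrow> real) list) \<Rightarrow> 'x luk_form \<Rightarrow> bool" where
  "dv_satisfies W \<phi> \<longleftrightarrow>
     (\<lambda>v\<in>cube (vars \<phi>). 1 - truth_fun (vars \<phi>) \<phi> v) \<in> dv_ideal (vars \<phi>) (W (vars \<phi>))"

definition dv_entails :: "'x set \<Rightarrow> 'x luk_form set \<Rightarrow> 'x luk_form \<Rightarrow> bool" where
  "dv_entails X \<Theta> \<psi> \<longleftrightarrow>
     (\<forall>W. is_diff_val_family X W \<longrightarrow> (\<forall>\<theta>\<in>\<Theta>. dv_satisfies W \<theta>) \<longrightarrow> dv_satisfies W \<psi>)"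

end

theory Submission imports Defs "HOL-Analysis.Analysis" begin

text \<open>
  Soundness: the simplices of a differential valuation decrease with \<open>m\<close>, so the formulas true on some
  simplex are closed under Modus Ponens, and domination transports truth between sets of variables.

  Completeness: if \<open>\<psi>\<close> is not derivable, extend \<open>\<Theta>\<close> to a theory \<open>T\<close> without \<open>\<psi>\<close> whose Lindenbaum
  algebra is totally ordered. Addition with carry embeds this chain into a totally ordered abelian
  group (Chang), and Fourier--Motzkin elimination moves the finitely many linear inequalities between
  the values of finitely many formulas from that group to the reals. So for every finite \<open>H\<close> there is
  a sequence of points of the cube such that each formula over \<open>H\<close> is in \<open>T\<close> iff it is true at almost all
  points of the sequence. The iterated tangent directions (Bouligand--Severi) of a subsequence form a
  differential valuation: an affine function has the same sign at the points of the subsequence as,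
  lexicographically, along the tangent directions, so each piecewise linear truth function is given by
  one and the same affine function on late points and on small simplices.
\<close>

section \<open>Theories of Lukasiewicz logic\<close>

text \<open>Single points of a cube cannot separate theories: already over one variable the
  Lindenbaum chain may contain infinitesimals (Chang's algebra), and every homomorphism to the reals
  collapses them. A real valuation can therefore be right for finitely many formulas only. This
  forces sequences of points, each right for more formulas than the one before, and it is the reason
  why the limit \<open>u\<^sub>0\<close> has to be supplemented by directions: they record in which
  order of smallness the sequence approaches it. Since only finitely many inequalities are moved to
  the reals at a time, no embedding theorem for ordered groups is needed; a preorder on multisets of
  formulas, compared through integer differences of multiplicities, does the work of the group. The
  sequences for different sets \<open>H\<close> are chosen independently of each other. Domination
  still holds, because it speaks only about the ideals, and all of these are read off the same
  theory \<open>T\<close>.\<close>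

lemma luk_axiom_map: "luk_axiom \<phi> \<Longrightarrow> luk_axiom (map_luk_form s \<phi>)"
  by (induction rule: luk_axiom.induct) (auto intro: luk_axiom.intros)

text \<open>Axioms are schemes, hence closed under renaming. Sending all variables outside
  \<open>X\<close> to \<open>x0\<close> brings a derivation over the whole type into
  \<open>FORM X\<close> and leaves the hypotheses fixed.\<close>

lemma luk_derives_subst:
  assumes "luk_derives UNIV \<Theta> \<phi>" and "\<Theta> \<subseteq> FORM X" and "x0 \<in> X"
  shows "luk_derives X \<Theta> (map_luk_form (\<lambda>x. if x \<in> X then x else x0) \<phi>)"
  using assms(1)
proof (induction rule: luk_derives.induct)
  case (hyp \<theta>)
  then have "map_luk_form (\<lambda>x. if x \<in> X then x else x0) \<theta> = \<theta>"
    using assms(2) by (intro luk_form.map_ident_strong) (auto simp: FORM_def)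
  with hyp show ?case by (simp add: luk_derives.hyp)
next
  case (ax \<phi>)
  then show ?case
    using assms(3) by (intro luk_derives.ax luk_axiom_map) (auto simp: FORM_def luk_form.set_map)
next
  case (mp \<phi> \<psi>)
  then show ?case by (auto intro: luk_derives.mp)
qed

lemma luk_derives_conservative:
  assumes "luk_derives UNIV \<Theta> \<psi>" and "\<Theta> \<subseteq> FORM X" and "\<psi> \<in> FORM X" and "X \<noteq> {}"
  shows "luk_derives X \<Theta> \<psi>"
proof -
  obtain x0 where x0: "x0 \<in> X" using assms(4) by blast
  have "map_luk_form (\<lambda>x. if x \<in> X then x else x0) \<psi> = \<psi>"
    using assms(3) by (intro luk_form.map_ident_strong) (auto simp: FORM_def)
  with luk_derives_subst[OF assms(1,2) x0] show ?thesis by simp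
qed

section \<open>Order and equivalence derived from the four axiom schemes\<close>

locale luk_theory =
  fixes T :: "'x luk_form set"
  assumes ax: "luk_axiom \<phi> \<Longrightarrow> \<phi> \<in> T"
    and mp: "\<phi> \<in> T \<Longrightarrow> Imp \<phi> \<psi> \<in> T \<Longrightarrow> \<psi> \<in> T"
begin

abbreviation le (infix "\<preceq>" 50) where "a \<preceq> b \<equiv> Imp a b \<in> T"

lemma weak: "a \<preceq> Imp b a"
  by (rule ax) (rule A1)

lemma suffix: "Imp a b \<preceq> Imp (Imp b c) (Imp a c)"
  by (rule ax) (rule A2)

lemma join_comm: "Imp (Imp a b) b \<preceq> Imp (Imp b a) a"
  by (rule ax) (rule A3)

lemma contrap: "Imp (Neg a) (Neg b) \<preceq> Imp b a"
  by (rule ax) (rule A4)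

lemma trans: "a \<preceq> b \<Longrightarrow> b \<preceq> c \<Longrightarrow> a \<preceq> c"
  by (rule mp[OF _ mp[OF _ suffix]])

lemma antimono_left: "a \<preceq> b \<Longrightarrow> Imp b c \<preceq> Imp a c"
  by (rule mp[OF _ suffix])

lemma top_le: "t \<in> T \<Longrightarrow> a \<preceq> t"
  by (rule mp[OF _ weak])

text \<open>Weakening makes \<open>Imp (Imp a t) t\<close> true, and A3 turns this join
  around.\<close>

lemma top_imp_le: "t \<in> T \<Longrightarrow> Imp t a \<preceq> a"
  by (rule mp[OF mp[OF _ weak] join_comm])

lemma refl: "a \<preceq> a"
  by (rule trans[OF weak top_imp_le[OF ax[OF A1]]])

text \<open>Weakening puts \<open>a\<close> below the join of \<open>b\<close> and \<open>a\<close>,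
  and A3 swaps the two. This internal Modus Ponens is what yields the exchange of premises.\<close>

lemma le_double: "a \<preceq> Imp (Imp a b) b"
  by (rule trans[OF weak join_comm])

lemma exchange_rule: "a \<preceq> Imp b c \<Longrightarrow> b \<preceq> Imp a c"
  by (rule trans[OF le_double antimono_left])

lemma prefix: "Imp b c \<preceq> Imp (Imp a b) (Imp a c)"
  by (rule exchange_rule) (rule suffix)

lemma mono_right: "b \<preceq> c \<Longrightarrow> Imp a b \<preceq> Imp a c"
  by (rule mp[OF _ prefix])

lemma exchange: "Imp a (Imp b c) \<preceq> Imp b (Imp a c)"
  by (rule trans[OF suffix antimono_left[OF le_double]])

definition eqv (infix "\<doteq>" 50) where "a \<doteq> b \<longleftrightarrow> a \<preceq> b \<and> b \<preceq> a"

lemma eqv_refl: "a \<doteq> a"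
  by (simp add: eqv_def refl)

lemma eqv_sym: "a \<doteq> b \<Longrightarrow> b \<doteq> a"
  by (simp add: eqv_def)

lemma eqv_trans [trans]: "a \<doteq> b \<Longrightarrow> b \<doteq> c \<Longrightarrow> a \<doteq> c"
  unfolding eqv_def by (blast intro: trans)

text \<open>
  A canonical representative of each class modulo provable equivalence; it replaces the quotient,
  which is not available as a type since it depends on \<open>T\<close>.
\<close>

definition rep where "rep a = (SOME b. a \<doteq> b)"

lemma eqv_rep: "a \<doteq> rep a"
  unfolding rep_def by (rule someI) (rule eqv_refl)

lemma rep_eq_iff: "rep a = rep b \<longleftrightarrow> a \<doteq> b"
proof
  assume "rep a = rep b"
  then show "a \<doteq> b" by (metis eqv_rep eqv_sym eqv_trans)
next
  assume "a \<doteq> b"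
  then have "a \<doteq> c \<longleftrightarrow> b \<doteq> c" for c by (meson eqv_sym eqv_trans)
  then show "rep a = rep b" by (simp add: rep_def)
qed

lemma Imp_cong: "a \<doteq> a' \<Longrightarrow> b \<doteq> b' \<Longrightarrow> Imp a b \<doteq> Imp a' b'"
  unfolding eqv_def by (auto intro: trans[OF antimono_left mono_right])

lemma exchange_eqv: "Imp a (Imp b c) \<doteq> Imp b (Imp a c)"
  by (simp add: eqv_def exchange)

lemma join_comm_eqv: "Imp (Imp a b) b \<doteq> Imp (Imp b a) a"
  by (simp add: eqv_def join_comm)

text \<open>The language has no truth constants, so a fixed theorem serves as 1 and its negation as
  0.\<close>

definition one where "one = Imp (Var undefined) (Var undefined)"

definition zero where "zero = Neg one"

lemma one_in: "one \<in> T"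
  by (simp add: one_def refl)

lemma one_Imp: "Imp one a \<doteq> a"
  by (simp add: eqv_def weak top_imp_le one_in)

lemma eqv_one_iff: "a \<doteq> one \<longleftrightarrow> a \<in> T"
  unfolding eqv_def by (auto intro: mp one_in top_le)

lemma zero_le: "zero \<preceq> a"
  unfolding zero_def by (rule trans[OF weak trans[OF contrap top_imp_le[OF one_in]]])

text \<open>The hard direction starts from \<open>Imp (Neg a) zero \<preceq> a\<close>: it puts
  \<open>Imp a zero\<close> below the join of \<open>Neg a\<close> and \<open>zero\<close>, and this
  join is below \<open>Neg a\<close> because \<open>zero\<close> is least.\<close>

lemma Neg_eqv: "Neg a \<doteq> Imp a zero"
proof -
  have Neg_le: "Neg b \<preceq> Imp b zero" for b
    unfolding zero_def by (rule trans[OF weak contrap])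
  have "Imp (Neg a) zero \<preceq> a"
    unfolding zero_def by (rule trans[OF contrap top_imp_le[OF one_in]])
  then have "Imp a zero \<preceq> Imp (Imp (Neg a) zero) zero"
    by (rule antimono_left)
  from trans[OF trans[OF this join_comm] top_imp_le[OF zero_le]]
  have "Imp a zero \<preceq> Neg a" .
  with Neg_le show ?thesis by (simp add: eqv_def)
qed

lemma Neg_cong: "a \<doteq> b \<Longrightarrow> Neg a \<doteq> Neg b"
  by (rule eqv_trans[OF eqv_trans[OF Neg_eqv Imp_cong[OF _ eqv_refl]] eqv_sym[OF Neg_eqv]])

lemma Neg_Neg: "Neg (Neg a) \<doteq> a"
proof -
  have "Neg (Neg a) \<doteq> Imp (Imp a zero) zero"
    by (rule eqv_trans[OF Neg_cong[OF Neg_eqv] Neg_eqv])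
  also have "Imp (Imp a zero) zero \<doteq> Imp (Imp zero a) a"
    by (rule join_comm_eqv)
  also have "Imp (Imp zero a) a \<doteq> Imp one a"
    by (simp add: Imp_cong eqv_one_iff eqv_refl zero_le)
  also have "Imp one a \<doteq> a" by (rule one_Imp)
  finally show ?thesis .
qed

lemma contrap_eqv: "Imp a b \<doteq> Imp (Neg b) (Neg a)"
proof -
  have "Imp (Neg b) (Neg a) \<doteq> Imp (Neg b) (Imp a zero)"
    by (simp add: Imp_cong Neg_eqv eqv_refl)
  also have "Imp (Neg b) (Imp a zero) \<doteq> Imp a (Imp (Neg b) zero)"
    by (rule exchange_eqv)
  also have "Imp a (Imp (Neg b) zero) \<doteq> Imp a b"
    by (rule Imp_cong[OF eqv_refl eqv_trans[OF eqv_sym[OF Neg_eqv] Neg_Neg]])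
  finally show ?thesis by (rule eqv_sym)
qed

text \<open>With \<open>c\<close> the join of \<open>a\<close> and \<open>b\<close>, the two
  implications are equivalent to \<open>Imp c b\<close> and \<open>Imp c a\<close>. After
  contraposition both end in \<open>Neg c\<close>; exchanging premises exposes the join of
  \<open>Neg b\<close> and \<open>Neg c\<close>, which is \<open>Neg b\<close>. So
  \<open>Imp (Imp a b) (Imp b a)\<close> collapses to \<open>Imp b a\<close>.\<close>

lemma prelinear: "Imp (Imp (Imp a b) (Imp b a)) (Imp b a) \<in> T"
proof -
  define c where "c = Imp (Imp a b) b"
  have bc: "b \<preceq> c" unfolding c_def by (rule weak)
  have ab: "Imp a b \<doteq> Imp c b"
    unfolding c_def eqv_def by (simp add: antimono_left le_double)
  have "Imp c a \<preceq> Imp b a" by (rule antimono_left[OF bc])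
  moreover have "Imp b a \<preceq> Imp c a"
  proof -
    have "Imp b a \<preceq> Imp (Imp (Imp b a) a) a" by (rule le_double)
    moreover have "Imp (Imp (Imp b a) a) a \<preceq> Imp c a"
      unfolding c_def by (rule antimono_left) (rule join_comm)
    ultimately show ?thesis by (rule trans)
  qed
  ultimately have ba: "Imp b a \<doteq> Imp c a" by (simp add: eqv_def)
  have "Imp (Imp a b) (Imp b a) \<doteq> Imp (Imp (Neg b) (Neg c)) (Imp (Neg a) (Neg c))"
    by (rule Imp_cong[OF eqv_trans[OF ab contrap_eqv] eqv_trans[OF ba contrap_eqv]])
  also have "\<dots> \<doteq> Imp (Neg a) (Imp (Imp (Neg b) (Neg c)) (Neg c))"
    by (rule exchange_eqv)
  also have "\<dots> \<doteq> Imp (Neg a) (Imp (Imp (Neg c) (Neg b)) (Neg b))"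
    by (simp add: Imp_cong eqv_refl join_comm_eqv)
  also have "\<dots> \<doteq> Imp (Neg a) (Neg b)"
  proof -
    have "Imp (Neg c) (Neg b) \<in> T"
      using bc contrap_eqv[of b c] by (auto simp: eqv_def intro: mp)
    then show ?thesis
      by (intro Imp_cong eqv_refl) (simp add: eqv_def top_imp_le weak)
  qed
  also have "\<dots> \<doteq> Imp b a"
    by (rule eqv_sym[OF contrap_eqv])
  finally show ?thesis by (simp add: eqv_def)
qed

text \<open>Truth of the join of \<open>\<eta>\<close> and \<open>y\<close> means
  \<open>Imp \<eta> y \<preceq> y\<close>. Transitivity gives \<open>Imp \<psi> y \<preceq> Imp (Imp
  \<eta> \<psi>) (Imp \<eta> y)\<close>, and the two assumptions shrink the right side to
  \<open>y\<close>.\<close>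

lemma join_mp:
  assumes "Imp (Imp \<eta> y) y \<in> T" and "Imp (Imp (Imp \<eta> \<psi>) y) y \<in> T"
  shows "Imp (Imp \<psi> y) y \<in> T"
  by (rule trans[OF trans[OF exchange_rule[OF suffix] mono_right[OF assms(1)]] assms(2)])

end

section \<open>Reasoning by cases and prime extensions\<close>

lemma luk_theory_derives: "luk_theory {\<phi>. luk_derives UNIV \<Theta> \<phi>}"
  by standard (auto intro: luk_derives.intros simp: FORM_def)

lemma (in luk_theory) derives_subset:
  assumes "luk_derives UNIV \<Theta> \<phi>" and "\<Theta> \<subseteq> T"
  shows "\<phi> \<in> T"
  using assms by (induction rule: luk_derives.induct) (auto intro: ax mp)

text \<open>Reasoning by cases: \<open>\<eta> \<squnion> y\<close> is \<open>(\<eta> \<rightarrow> y) \<rightarrow> y\<close>, and the \<open>\<eta>\<close> with \<open>\<eta> \<squnion> y \<in> T\<close> form a theory.\<close>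

lemma (in luk_theory) join_theory: "luk_theory {\<eta>. Imp (Imp \<eta> y) y \<in> T}"
proof
  show "\<phi> \<in> {\<eta>. Imp (Imp \<eta> y) y \<in> T}" if "luk_axiom \<phi>" for \<phi>
    using ax[OF that] by (simp add: top_imp_le)
qed (auto intro: join_mp)

lemma (in luk_theory) derives_cases:
  assumes "Imp (Imp x y) y \<in> T"
    and "luk_derives UNIV (insert x T) \<psi>" and "luk_derives UNIV (insert y T) \<psi>"
  shows "\<psi> \<in> T"
proof -
  have "\<psi> \<in> {\<eta>. Imp (Imp \<eta> y) y \<in> T}"
    by (rule luk_theory.derives_subset[OF join_theory assms(2)])
       (use assms(1) in \<open>auto intro: top_imp_le\<close>)
  \<comment> \<open>The join is turned around so that the theory for the second case has
    \<open>\<psi>\<close> itself as its fixed disjunct; the join of \<open>\<psi>\<close> with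
    \<open>\<psi>\<close> then gives \<open>\<psi>\<close>.\<close>
  then have "Imp (Imp y \<psi>) \<psi> \<in> T"
    by (auto intro: mp join_comm)
  then have "\<psi> \<in> {\<eta>. Imp (Imp \<eta> \<psi>) \<psi> \<in> T}"
    by (intro luk_theory.derives_subset[OF join_theory assms(3)])
       (auto intro: top_imp_le)
  then show ?thesis by (auto intro: mp refl)
qed

text \<open>A theory maximal among those omitting \<open>\<psi>\<close> derives
  \<open>\<psi>\<close> as soon as any formula is added. If \<open>Imp a b\<close> and
  \<open>Imp b a\<close> were both missing, both additions would derive \<open>\<psi>\<close>, and
  prelinearity allows reasoning by these two cases.\<close>

lemma prime_theory_exists:
  assumes "\<not> luk_derives UNIV \<Theta> \<psi>"
  obtains T where "luk_theory T" "\<Theta> \<subseteq> T" "\<psi> \<notin> T" "\<forall>a b. Imp a b \<in> T \<or> Imp b a \<in> T"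
proof -
  define \<T> where "\<T> = {T. luk_theory T \<and> \<Theta> \<subseteq> T \<and> \<psi> \<notin> T}"
  have "{\<phi>. luk_derives UNIV \<Theta> \<phi>} \<in> \<T>"
    using assms luk_theory_derives[of \<Theta>] by (auto simp: \<T>_def intro: luk_derives.hyp)
  then have "\<T> \<noteq> {}" by blast
  moreover have "\<Union>C \<in> \<T>" if ne: "C \<noteq> {}" and chain: "subset.chain \<T> C" for C
  proof -
    have C: "T \<in> C \<Longrightarrow> luk_theory T \<and> \<Theta> \<subseteq> T \<and> \<psi> \<notin> T" for T
      using chain by (auto simp: \<T>_def subset_chain_def)
    have "luk_theory (\<Union>C)"
    proof
      fix \<phi> :: "'a luk_form" assume "luk_axiom \<phi>"
      then show "\<phi> \<in> \<Union>C" using ne C luk_theory.ax by blast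
    next
      fix \<phi> \<eta> assume "\<phi> \<in> \<Union>C" "Imp \<phi> \<eta> \<in> \<Union>C"
      then obtain S where "S \<in> C" "\<phi> \<in> S" "Imp \<phi> \<eta> \<in> S"
        using chain unfolding subset_chain_def by (metis UnionE subsetD)
      then show "\<eta> \<in> \<Union>C" using C[of S] luk_theory.mp[of S \<phi> \<eta>] by blast
    qed
    then show ?thesis using ne C unfolding \<T>_def by blast
  qed
  ultimately obtain T where T: "T \<in> \<T>" and max: "\<And>S. S \<in> \<T> \<Longrightarrow> T \<subseteq> S \<Longrightarrow> S = T"
    using subset_Zorn_nonempty[of \<T>] by metis
  interpret luk_theory T using T by (simp add: \<T>_def)
  have ext: "luk_derives UNIV (insert x T) \<psi>" if "x \<notin> T" for x
  proof (rule ccontr)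
    assume "\<not> ?thesis"
    then have "{\<phi>. luk_derives UNIV (insert x T) \<phi>} \<in> \<T>"
      using T luk_theory_derives[of "insert x T"] by (auto simp: \<T>_def intro: luk_derives.hyp)
    then have "{\<phi>. luk_derives UNIV (insert x T) \<phi>} = T"
      by (rule max) (auto intro: luk_derives.hyp)
    then show False using that by (auto intro: luk_derives.hyp)
  qed
  have "Imp a b \<in> T \<or> Imp b a \<in> T" for a b
  proof (rule ccontr)
    assume "\<not> ?thesis"
    then have "\<psi> \<in> T"
      using derives_cases[OF prelinear[of a b]] ext by blast
    then show False using T by (simp add: \<T>_def)
  qed
  then show ?thesis using that[of T] T unfolding \<T>_def by blast
qed

section \<open>Fourier--Motzkin elimination\<close>

text \<open>Compare the largest lower bound with the smallest upper bound. If they differ, the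
  midpoint works; if they coincide, no strict bound has this value, and the common value
  works.\<close>

lemma between_bounds:
  fixes Ls Us Lw Uw :: "real set"
  assumes fin: "finite Ls" "finite Us" "finite Lw" "finite Uw"
    and "\<And>a b. a \<in> Ls \<Longrightarrow> b \<in> Us \<union> Uw \<Longrightarrow> a < b"
    and "\<And>a b. a \<in> Lw \<Longrightarrow> b \<in> Us \<Longrightarrow> a < b"
    and "\<And>a b. a \<in> Lw \<Longrightarrow> b \<in> Uw \<Longrightarrow> a \<le> b"
  shows "\<exists>t. (\<forall>a\<in>Ls. a < t) \<and> (\<forall>a\<in>Lw. a \<le> t) \<and> (\<forall>b\<in>Us. t < b) \<and> (\<forall>b\<in>Uw. t \<le> b)"
proof (cases "Ls \<union> Lw = {}")
  case True
  show ?thesis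
  proof (cases "Us \<union> Uw = {}")
    case True
    with \<open>Ls \<union> Lw = {}\<close> show ?thesis by auto
  next
    case False
    have "Min (Us \<union> Uw) - 1 < b" if "b \<in> Us \<union> Uw" for b
    proof -
      have "Min (Us \<union> Uw) \<le> b" using fin that by (intro Min_le) auto
      then show ?thesis by simp
    qed
    with \<open>Ls \<union> Lw = {}\<close> show ?thesis
      by (intro exI[of _ "Min (Us \<union> Uw) - 1"]) (auto simp: less_imp_le)
  qed
next
  case L: False
  define l where "l = Max (Ls \<union> Lw)"
  have l: "l \<in> Ls \<union> Lw" "\<And>a. a \<in> Ls \<union> Lw \<Longrightarrow> a \<le> l"
    unfolding l_def using L fin Max_in[of "Ls \<union> Lw"] by auto
  show ?thesis
  proof (cases "Us \<union> Uw = {}")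
    case True
    have "a \<in> Ls \<union> Lw \<Longrightarrow> a < l + 1" for a using l(2)[of a] by simp
    with True show ?thesis by (intro exI[of _ "l + 1"]) (auto simp: less_imp_le)
  next
    case U: False
    define u where "u = Min (Us \<union> Uw)"
    have u: "u \<in> Us \<union> Uw" "\<And>b. b \<in> Us \<union> Uw \<Longrightarrow> u \<le> b"
      unfolding u_def using U fin Min_in[of "Us \<union> Uw"] by auto
    have "l \<le> u" using l(1) u(1) assms(5-7) by (force simp: less_imp_le)
    then consider "l < u" | "l = u" by linarith
    then show ?thesis
    proof cases
      case 1
      have "a \<in> Ls \<union> Lw \<Longrightarrow> a < (l + u) / 2" for a using l(2)[of a] 1 by simp
      moreover have "b \<in> Us \<union> Uw \<Longrightarrow> (l + u) / 2 < b" for b using u(2)[of b] 1 by simp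
      ultimately show ?thesis by (intro exI[of _ "(l + u) / 2"]) (auto simp: less_imp_le)
    next
      case 2
      have "a < l" if "a \<in> Ls" for a using assms(5)[OF that u(1)] 2 by simp
      moreover have "l < b" if "b \<in> Us" for b
        using l(1) assms(5)[of l b] assms(6)[of l b] that by auto
      ultimately show ?thesis using l(2) u(2) 2 by (intro exI[of _ l]) auto
    qed
  qed
qed

text \<open>
  \<open>P\<close> plays the role of the nonnegative cone of a preordered group, and \<open>P f \<and> \<not> P (- f)\<close> that of
  strict positivity.
\<close>

lemma cone_scale:
  fixes P :: "('a \<Rightarrow> int) \<Rightarrow> bool"
  assumes add: "\<And>f g. P f \<Longrightarrow> P g \<Longrightarrow> P (\<lambda>x. f x + g x)" and "P f" and "k > 0"
  shows "P (\<lambda>x. int k * f x)"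
  using assms(3)
proof (induction k rule: nat_induct_non_zero)
  case 1
  then show ?case using assms(2) by simp
next
  case (Suc n)
  from add[OF assms(2) Suc.IH] show ?case by (simp add: algebra_simps)
qed

text \<open>Adding \<open>k - 1\<close> copies of \<open>f\<close> to \<open>- k * f\<close> would
  leave \<open>- f\<close>. The case \<open>k = 1\<close> is separate because \<open>P\<close> is
  not assumed to contain 0.\<close>

lemma cone_scale_strict:
  fixes P :: "('a \<Rightarrow> int) \<Rightarrow> bool"
  assumes add: "\<And>f g. P f \<Longrightarrow> P g \<Longrightarrow> P (\<lambda>x. f x + g x)"
    and "P f" and "\<not> P (\<lambda>x. - f x)" and "k > 0"
  shows "\<not> P (\<lambda>x. - (int k * f x))"
proof
  assume neg: "P (\<lambda>x. - (int k * f x))"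
  show False
  proof (cases "k = 1")
    case True
    with neg assms(3) show False by simp
  next
    case False
    then have "P (\<lambda>x. int (k - 1) * f x)"
      using cone_scale[of P f "k - 1"] add assms by simp
    from add[OF this neg] have "P (\<lambda>x. int (k - 1) * f x + - (int k * f x))" .
    moreover have "(\<lambda>x. int (k - 1) * f x + - (int k * f x)) = (\<lambda>x. - f x)"
      using assms(4) by (auto simp: of_nat_diff algebra_simps)
    ultimately show False using assms(3) by simp
  qed
qed

text \<open>\<open>D\<close> holds the strict and \<open>E\<close> the weak inequalities to be
  solved over the reals; \<open>P\<close> certifies that they are consistent. Each elimination of a
  coordinate replaces them by positive combinations, which \<open>P\<close> still certifies, and
  back substitution then chooses the eliminated value between finitely many bounds.\<close>

lemma fourier_motzkin:
  fixes P :: "('a \<Rightarrow> int) \<Rightarrow> bool"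
  assumes add: "\<And>f g. P f \<Longrightarrow> P g \<Longrightarrow> P (\<lambda>x. f x + g x)"
    and "finite F" and "finite D" and "finite E"
    and "\<And>f. f \<in> D \<Longrightarrow> P f \<and> \<not> P (\<lambda>x. - f x)" and "\<And>f. f \<in> E \<Longrightarrow> P f"
    and "\<And>f x. f \<in> D \<union> E \<Longrightarrow> x \<notin> F \<Longrightarrow> f x = 0"
  shows "\<exists>w :: 'a \<Rightarrow> real. (\<forall>f\<in>D. (\<Sum>x\<in>F. w x * of_int (f x)) > 0) \<and>
           (\<forall>f\<in>E. (\<Sum>x\<in>F. w x * of_int (f x)) \<ge> 0)"
  using assms(2-)
proof (induction F arbitrary: D E rule: finite_induct)
  case empty
  \<comment> \<open>Without coordinates a member of \<open>D\<close> is the zero function, which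
    equals its own negative and so cannot be strictly positive.\<close>
  have "D = {}"
  proof (rule ccontr)
    assume "D \<noteq> {}"
    then obtain f where "f \<in> D" by blast
    with empty have "f = (\<lambda>x. 0)" "P f" "\<not> P (\<lambda>x. - f x)" by auto
    then show False by simp
  qed
  then show ?case by simp
next
  case (insert y F)
  \<comment> \<open>The multipliers are positive for \<open>g y < 0 < f y\<close> and cancel the
    coefficient at \<open>y\<close>.\<close>
  define comb :: "('a \<Rightarrow> int) \<Rightarrow> ('a \<Rightarrow> int) \<Rightarrow> 'a \<Rightarrow> int"
    where "comb = (\<lambda>f g x. - g y * f x + f y * g x)"
  have comb: "P (comb f g)" if "P f" "P g" "f y > 0" "g y < 0" for f g
  proof -
    have "P (\<lambda>x. int (nat (- g y)) * f x)" "P (\<lambda>x. int (nat (f y)) * g x)"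
      by (rule cone_scale[of P, OF add]; use that in simp)+
    from add[OF this] show ?thesis using that by (simp add: comb_def)
  qed
  have comb_strict: "\<not> P (\<lambda>x. - comb f g x)"
    if "P f" "P g" "f y > 0" "g y < 0" "\<not> P (\<lambda>x. - f x) \<or> \<not> P (\<lambda>x. - g x)" for f g
  proof
    assume n: "P (\<lambda>x. - comb f g x)"
    have p: "P (\<lambda>x. int (nat (- g y)) * f x)" "P (\<lambda>x. int (nat (f y)) * g x)"
      by (rule cone_scale[of P, OF add]; use that in simp)+
    from that(5) show False
    proof
      assume f: "\<not> P (\<lambda>x. - f x)"
      have "P (\<lambda>x. - (int (nat (- g y)) * f x))"
        using add[OF n p(2)] that by (simp add: comb_def algebra_simps)
      then show False using cone_scale_strict[of P f "nat (- g y)"] add that f by auto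
    next
      assume g: "\<not> P (\<lambda>x. - g x)"
      have "P (\<lambda>x. - (int (nat (f y)) * g x))"
        using add[OF n p(1)] that by (simp add: comb_def algebra_simps)
      then show False using cone_scale_strict[of P g "nat (f y)"] add that g by auto
    qed
  qed
  define pos where "pos = (\<lambda>A :: ('a \<Rightarrow> int) set. {f \<in> A. f y > 0})"
  define neg where "neg = (\<lambda>A :: ('a \<Rightarrow> int) set. {f \<in> A. f y < 0})"
  \<comment> \<open>A combination is strict as soon as one of its two members is, hence the pairs
    with a member of \<open>D\<close> go here and the purely weak pairs into
    \<open>E'\<close>.\<close>
  define D' where "D' = {f \<in> D. f y = 0} \<union> (\<lambda>(f, g). comb f g) `
    (pos D \<times> neg (D \<union> E) \<union> pos E \<times> neg D)"
  define E' where "E' = {f \<in> E. f y = 0} \<union> (\<lambda>(f, g). comb f g) ` (pos E \<times> neg E)"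
  have "\<exists>w :: 'a \<Rightarrow> real. (\<forall>f\<in>D'. (\<Sum>x\<in>F. w x * of_int (f x)) > 0) \<and>
           (\<forall>f\<in>E'. (\<Sum>x\<in>F. w x * of_int (f x)) \<ge> 0)"
  proof (rule insert.IH)
    show "finite D'" "finite E'"
      using insert.prems by (auto simp: D'_def E'_def pos_def neg_def)
    show "P f \<and> \<not> P (\<lambda>x. - f x)" if "f \<in> D'" for f
      using that insert.prems(3,4) unfolding D'_def pos_def neg_def
      by (auto intro!: comb simp: comb_strict)
    show "P f" if "f \<in> E'" for f
      using that insert.prems(4) unfolding E'_def pos_def neg_def by (auto intro!: comb)
    show "f x = 0" if "f \<in> D' \<union> E'" "x \<notin> F" for f x
    proof (cases "x = y")
      case True
      then show ?thesis using that unfolding D'_def E'_def by (auto simp: comb_def)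
    next
      case False
      then have z: "g \<in> D \<Longrightarrow> g x = 0" "g \<in> E \<Longrightarrow> g x = 0" for g
        using insert.prems(5)[of g x] \<open>x \<notin> F\<close> by simp_all
      have c: "comb g h x = 0" if "g \<in> D \<union> E" "h \<in> D \<union> E" for g h
        using that z[of g] z[of h] by (auto simp: comb_def)
      show ?thesis
        using that(1) unfolding D'_def E'_def pos_def neg_def by (auto intro: z c)
    qed
  qed
  then obtain w :: "'a \<Rightarrow> real" where
    wD: "\<And>f. f \<in> D' \<Longrightarrow> (\<Sum>x\<in>F. w x * of_int (f x)) > 0" and
    wE: "\<And>f. f \<in> E' \<Longrightarrow> (\<Sum>x\<in>F. w x * of_int (f x)) \<ge> 0" by blast
  define s where "s = (\<lambda>f :: 'a \<Rightarrow> int. \<Sum>x\<in>F. w x * of_int (f x))"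
  \<comment> \<open>The inequality for \<open>f\<close> with value \<open>t\<close> at
    \<open>y\<close> reads \<open>t * f y + s f > 0\<close> (or \<open>\<ge> 0\<close>):
    \<open>b f\<close> is a lower bound on \<open>t\<close> if \<open>f y > 0\<close> and an upper
    bound if \<open>f y < 0\<close>.\<close>
  define b where "b = (\<lambda>f :: 'a \<Rightarrow> int. - s f / of_int (f y))"
  have s_comb: "s (comb f g) = - of_int (g y) * s f + of_int (f y) * s g" for f g
    unfolding s_def comb_def sum_distrib_left sum.distrib[symmetric]
    by (intro sum.cong) (auto simp: algebra_simps)
  have less: "b f < b g" if "s (comb f g) > 0" "f y > 0" "g y < 0" for f g
    using that unfolding s_comb b_def by (simp add: field_simps)
  have le: "b f \<le> b g" if "s (comb f g) \<ge> 0" "f y > 0" "g y < 0" for f g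
    using that unfolding s_comb b_def by (simp add: field_simps)
  have "\<exists>t. (\<forall>a\<in>b ` pos D. a < t) \<and> (\<forall>a\<in>b ` pos E. a \<le> t) \<and>
        (\<forall>a\<in>b ` neg D. t < a) \<and> (\<forall>a\<in>b ` neg E. t \<le> a)"
  proof (rule between_bounds)
    show "finite (b ` pos D)" "finite (b ` neg D)" "finite (b ` pos E)" "finite (b ` neg E)"
      using insert.prems by (auto simp: pos_def neg_def)
    have pn: "s (comb f g) > 0" if "f \<in> pos D \<and> g \<in> neg (D \<union> E) \<or> f \<in> pos E \<and> g \<in> neg D" for f g
      unfolding s_def by (rule wD) (use that in \<open>auto simp: D'_def\<close>)
    show "a < a'" if "a \<in> b ` pos D" "a' \<in> b ` neg D \<union> b ` neg E" for a a'
      using that less pn by (auto simp: pos_def neg_def)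
    show "a < a'" if "a \<in> b ` pos E" "a' \<in> b ` neg D" for a a'
      using that less pn by (auto simp: pos_def neg_def)
    have "s (comb f g) \<ge> 0" if "f \<in> pos E" "g \<in> neg E" for f g
      unfolding s_def by (rule wE) (use that in \<open>auto simp: E'_def\<close>)
    then show "a \<le> a'" if "a \<in> b ` pos E" "a' \<in> b ` neg E" for a a'
      using that le by (auto simp: pos_def neg_def)
  qed
  then obtain t where t: "\<forall>a\<in>b ` pos D. a < t" "\<forall>a\<in>b ` pos E. a \<le> t"
    "\<forall>a\<in>b ` neg D. t < a" "\<forall>a\<in>b ` neg E. t \<le> a" by (elim exE conjE)
  define w' where "w' = w(y := t)"
  have w': "(\<Sum>x\<in>insert y F. w' x * of_int (f x)) = t * of_int (f y) + s f" for f
  proof -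
    have "(\<Sum>x\<in>F. w' x * of_int (f x)) = s f"
      unfolding s_def w'_def using insert.hyps by (intro sum.cong) auto
    then show ?thesis using insert.hyps by (simp add: w'_def)
  qed
  have "t * of_int (f y) + s f > 0" if "f \<in> D" for f
  proof (cases "f y" "0 :: int" rule: linorder_cases)
    case less
    then have "t < b f" using t(3) that by (auto simp: neg_def)
    with less show ?thesis by (simp add: b_def field_simps)
  next
    case equal
    with wD[of f] that show ?thesis by (simp add: D'_def s_def)
  next
    case greater
    then have "b f < t" using t(1) that by (auto simp: pos_def)
    with greater show ?thesis by (simp add: b_def field_simps)
  qed
  moreover have "t * of_int (f y) + s f \<ge> 0" if "f \<in> E" for f
  proof (cases "f y" "0 :: int" rule: linorder_cases)
    case less
    then have "t \<le> b f" using t(4) that by (auto simp: neg_def)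
    with less show ?thesis by (simp add: b_def field_simps)
  next
    case equal
    with wE[of f] that show ?thesis by (simp add: E'_def s_def)
  next
    case greater
    then have "b f \<le> t" using t(2) that by (auto simp: pos_def)
    with greater show ?thesis by (simp add: b_def field_simps)
  qed
  ultimately show ?case by (intro exI[of _ w']) (simp add: w')
qed

section \<open>Totally ordered MV-algebras\<close>

text \<open>The MV-algebra lives on the elements fixed by \<open>rp\<close>. The operations accept
  arbitrary elements and return representatives, so \<open>rp\<close> appears wherever the usual
  axioms have the identity.\<close>

locale mv_chain =
  fixes rp :: "'a \<Rightarrow> 'a" and ng :: "'a \<Rightarrow> 'a" and pl :: "'a \<Rightarrow> 'a \<Rightarrow> 'a" (infixl "\<boxplus>" 65)
    and z :: 'a
  assumes pl_commute: "a \<boxplus> b = b \<boxplus> a"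
    and pl_assoc: "(a \<boxplus> b) \<boxplus> c = a \<boxplus> (b \<boxplus> c)"
    and pl_z [simp]: "a \<boxplus> z = rp a"
    and rp_pl [simp]: "rp a \<boxplus> b = a \<boxplus> b"
    and rp_z [simp]: "rp z = z"
    and ng_rp [simp]: "ng (rp a) = ng a"
    and rp_ng [simp]: "rp (ng a) = ng a"
    and ng_ng [simp]: "ng (ng a) = rp a"
    and pl_top [simp]: "a \<boxplus> ng z = ng z"
    and join_commute: "ng (ng a \<boxplus> b) \<boxplus> b = ng (ng b \<boxplus> a) \<boxplus> a"
    and total: "ng a \<boxplus> b = ng z \<or> ng b \<boxplus> a = ng z"
    and nontrivial: "ng z \<noteq> z"
begin

abbreviation top ("I") where "I \<equiv> ng z"

definition below (infix "\<sqsubseteq>" 50) where "a \<sqsubseteq> b \<longleftrightarrow> ng a \<boxplus> b = I"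

text \<open>The Lukasiewicz product, max(0, a + b - 1) in the unit interval: what remains of
  \<open>a + b\<close> after a carry.\<close>

definition pr (infixl "\<boxdot>" 70) where "a \<boxdot> b = ng (ng a \<boxplus> ng b)"

lemma pl_left_commute: "a \<boxplus> (b \<boxplus> c) = b \<boxplus> (a \<boxplus> c)"
  by (metis pl_assoc pl_commute)

lemmas pl_ac = pl_assoc pl_commute pl_left_commute

lemma z_pl [simp]: "z \<boxplus> a = rp a"
  by (simp add: pl_commute[of z])

lemma top_pl [simp]: "I \<boxplus> a = I"
  by (simp add: pl_commute[of I])

lemma pl_rp [simp]: "a \<boxplus> rp b = a \<boxplus> b"
  by (simp add: pl_commute[of a])

lemma rp_of_pl [simp]: "rp (a \<boxplus> b) = a \<boxplus> b"
  by (metis pl_assoc pl_rp pl_z)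

lemma compl: "ng a \<boxplus> a = I"
  using join_commute[of I a] by simp

lemma below_refl: "a \<sqsubseteq> a"
  by (simp add: below_def compl)

lemma below_rp [simp]: "rp a \<sqsubseteq> b \<longleftrightarrow> a \<sqsubseteq> b" "a \<sqsubseteq> rp b \<longleftrightarrow> a \<sqsubseteq> b"
  by (simp_all add: below_def)

lemma below_antisym: "a \<sqsubseteq> b \<Longrightarrow> b \<sqsubseteq> a \<Longrightarrow> rp a = rp b"
  using join_commute[of a b] by (simp add: below_def)

lemma below_total: "a \<sqsubseteq> b \<or> b \<sqsubseteq> a"
  using total by (simp add: below_def)

lemma below_decomp: "a \<sqsubseteq> b \<Longrightarrow> rp b = a \<boxplus> ng (ng b \<boxplus> a)"
  using join_commute[of a b] by (simp add: below_def pl_commute)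

lemma below_pl: "a \<sqsubseteq> a \<boxplus> c"
  unfolding below_def pl_assoc[symmetric] by (simp add: compl)

lemma below_trans: "a \<sqsubseteq> b \<Longrightarrow> b \<sqsubseteq> c \<Longrightarrow> a \<sqsubseteq> c"
  using below_decomp[of b c] by (metis below_def pl_assoc pl_rp top_pl)

lemma pl_mono: "a \<sqsubseteq> b \<Longrightarrow> a \<boxplus> c \<sqsubseteq> b \<boxplus> c"
proof -
  assume "a \<sqsubseteq> b"
  then have "b \<boxplus> c = (a \<boxplus> c) \<boxplus> ng (ng b \<boxplus> a)"
    using below_decomp[of a b] rp_pl[of b c] by (simp add: pl_ac)
  then show ?thesis by (simp add: below_pl)
qed

lemma z_below: "z \<sqsubseteq> a"
  by (simp add: below_def)

lemma below_top: "a \<sqsubseteq> I"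
  by (simp add: below_def)

lemma top_below: "I \<sqsubseteq> a \<longleftrightarrow> rp a = I"
  by (simp add: below_def)

lemma pl_eq_top: "a \<boxplus> b = I \<longleftrightarrow> ng a \<sqsubseteq> b"
  by (simp add: below_def)

lemma ng_below_ng: "ng a \<sqsubseteq> ng b \<longleftrightarrow> b \<sqsubseteq> a"
  by (simp add: below_def pl_commute)

lemma below_ng: "a \<sqsubseteq> ng b \<longleftrightarrow> b \<sqsubseteq> ng a"
  by (simp add: below_def pl_commute)

lemma pr_commute: "a \<boxdot> b = b \<boxdot> a"
  by (simp add: pr_def pl_commute)

lemma ng_pr [simp]: "ng (a \<boxdot> b) = ng a \<boxplus> ng b"
  by (simp add: pr_def)

lemma ng_pl: "ng (a \<boxplus> b) = ng a \<boxdot> ng b"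
  by (simp add: pr_def)

lemma rp_pr [simp]: "rp (a \<boxdot> b) = a \<boxdot> b" "rp a \<boxdot> b = a \<boxdot> b" "a \<boxdot> rp b = a \<boxdot> b"
  by (simp_all add: pr_def)

lemma pr_assoc: "(a \<boxdot> b) \<boxdot> c = a \<boxdot> (b \<boxdot> c)"
  by (simp add: pr_def pl_assoc)

lemma pr_below: "a \<boxdot> b \<sqsubseteq> a"
  by (simp add: below_def pl_commute[of _ a]) (metis compl pl_assoc pl_commute top_pl)

text \<open>Truncated subtraction of \<open>b\<close> followed by adding it back is the join of
  \<open>a\<close> and \<open>b\<close>. This and its dual \<open>meet_eq\<close> are the
  cancellation laws behind all carry computations.\<close>

lemma join_eq: "b \<sqsubseteq> a \<Longrightarrow> (a \<boxdot> ng b) \<boxplus> b = rp a"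
  using below_decomp[of b a] by (simp add: pr_def pl_commute)

lemma meet_eq: "b \<sqsubseteq> a \<Longrightarrow> a \<boxdot> (ng a \<boxplus> b) = rp b"
proof -
  assume "b \<sqsubseteq> a"
  then have "(ng b \<boxdot> ng (ng a)) \<boxplus> ng a = rp (ng b)"
    by (intro join_eq) (simp add: ng_below_ng)
  then have "ng ((ng b \<boxdot> a) \<boxplus> ng a) = rp b"
    by simp
  then show ?thesis by (simp add: ng_pl pr_commute pl_commute)
qed

text \<open>
  The next three identities express that addition with carry is independent of the order of the
  summands; they correspond to no carry so far, one carry, and two carries.
\<close>

lemma carry_comm_0:
  assumes "a \<sqsubseteq> ng b" and "a \<sqsubseteq> ng c" and "(a \<boxplus> b) \<boxplus> c = I"
  shows "(a \<boxplus> b) \<boxdot> c = (a \<boxplus> c) \<boxdot> b"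
proof -
  \<comment> \<open>In numbers, d = 1 - a - b and x = a + b + c - 1. Hence c = x + d and a + c = (1
    - b) + x, and the product of the latter with \<open>b\<close> is the meet of \<open>b\<close>
    and \<open>x\<close>.\<close>
  define d where "d = ng (a \<boxplus> b)"
  define x where "x = (a \<boxplus> b) \<boxdot> c"
  have "d \<sqsubseteq> c" using assms(3) by (simp add: d_def below_def)
  then have c: "x \<boxplus> d = rp c"
    using join_eq[of d c] by (simp add: x_def d_def pr_commute)
  have "d \<boxplus> a = ng b"
    using join_eq[OF assms(1)] by (simp add: d_def ng_pl pr_commute)
  then have "a \<boxplus> c = ng b \<boxplus> x"
    using c pl_rp[of a c] by (metis pl_commute pl_left_commute)
  moreover have "x \<sqsubseteq> b"
  proof -
    have "ng (a \<boxplus> b) \<boxplus> b = ng a"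
      using join_eq[of b "ng a"] assms(1) by (simp add: ng_pl below_ng)
    then have "ng x \<boxplus> b = ng c \<boxplus> ng a"
      by (simp add: x_def) (metis pl_assoc pl_commute)
    then show ?thesis using assms(2) by (simp add: below_def pl_commute)
  qed
  ultimately show ?thesis
    using meet_eq[of x b] by (simp add: pr_commute x_def)
qed

lemma carry_comm_1:
  assumes "a \<boxplus> b = I" and "a \<boxplus> c \<noteq> I"
  shows "(a \<boxdot> b) \<boxplus> c = (a \<boxplus> c) \<boxdot> b" and "(a \<boxdot> b) \<boxplus> c \<noteq> I"
proof -
  \<comment> \<open>In numbers, d = 1 - a - c and x = a + b - 1, so b = d + (x + c). The product
    with \<open>ng d\<close>, which is a + c, then gives the smaller of a + c and x + c.\<close>
  define d where "d = ng (a \<boxplus> c)"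
  define x where "x = a \<boxdot> b"
  have "c \<sqsubseteq> ng a" using assms(2) below_total[of c "ng a"] by (simp add: pl_eq_top)
  then have a: "d \<boxplus> c = ng a"
    using join_eq[of c "ng a"] by (simp add: d_def ng_pl)
  have "x \<boxplus> ng a = rp b"
    using join_eq[of "ng a" b] assms(1) by (simp add: x_def pl_eq_top pr_commute)
  then have b: "rp b = d \<boxplus> (x \<boxplus> c)"
    unfolding a[symmetric] by (simp add: pl_left_commute)
  have le: "x \<boxplus> c \<sqsubseteq> a \<boxplus> c" by (simp add: x_def pl_mono pr_below)
  then have "ng d \<boxdot> (ng (ng d) \<boxplus> (x \<boxplus> c)) = x \<boxplus> c"
    using meet_eq[of "x \<boxplus> c" "ng d"] by (simp add: d_def)
  then have "ng d \<boxdot> b = x \<boxplus> c"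
    using b rp_pr(3)[of "ng d" b] by simp
  then show "(a \<boxdot> b) \<boxplus> c = (a \<boxplus> c) \<boxdot> b"
    by (simp add: x_def d_def)
  show "(a \<boxdot> b) \<boxplus> c \<noteq> I"
    using le assms(2) by (auto simp: x_def top_below)
qed

lemma carry_comm_2:
  assumes "ng a \<sqsubseteq> b" and "ng a \<sqsubseteq> c" and "(a \<boxdot> b) \<boxdot> c = z"
  shows "(a \<boxdot> b) \<boxplus> c = (a \<boxdot> c) \<boxplus> b"
proof -
  \<comment> \<open>Negation interchanges sum and product, so this is \<open>carry_comm_0\<close>
    for the complements.\<close>
  have "ng ((a \<boxdot> b) \<boxdot> c) = I" using assms(3) by simp
  then have "(ng a \<boxplus> ng b) \<boxplus> ng c = I" by simp
  with assms have "(ng a \<boxplus> ng b) \<boxdot> ng c = (ng a \<boxplus> ng c) \<boxdot> ng b"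
    by (intro carry_comm_0) simp_all
  then have "ng ((ng a \<boxplus> ng b) \<boxdot> ng c) = ng ((ng a \<boxplus> ng c) \<boxdot> ng b)" by simp
  then show ?thesis by (simp add: ng_pl)
qed

section \<open>Addition with carry: the positive part of Chang's group\<close>

text \<open>
  The positive part of Chang's totally ordered group: \<open>(n, a)\<close> with \<open>a \<noteq> I\<close> stands for \<open>n \<cdot> I + a\<close>.
\<close>

definition tr :: "'a \<Rightarrow> nat \<times> 'a \<Rightarrow> nat \<times> 'a" where
  "tr b = (\<lambda>(n, a). if a \<boxplus> b = I then (Suc n, a \<boxdot> b) else (n, a \<boxplus> b))"

lemma tr_commute: "tr b (tr c x) = tr c (tr b x)"
proof -
  obtain n a where x: "x = (n, a)" by (cases x)
  consider "a \<boxplus> b \<noteq> I" "a \<boxplus> c \<noteq> I" | "a \<boxplus> b = I" "a \<boxplus> c \<noteq> I" | "a \<boxplus> b \<noteq> I" "a \<boxplus> c = I"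
    | "a \<boxplus> b = I" "a \<boxplus> c = I" by blast
  then show ?thesis
  proof cases
    case 1
    then have "a \<sqsubseteq> ng b" "a \<sqsubseteq> ng c"
      using below_total[of "ng a" b] below_total[of "ng a" c]
        below_total[of "ng b" a] below_total[of "ng c" a] by (auto simp: pl_eq_top pl_commute)
         (metis pl_commute pl_eq_top)+
    moreover have "(a \<boxplus> b) \<boxplus> c = (a \<boxplus> c) \<boxplus> b" by (simp add: pl_ac)
    ultimately show ?thesis
      using 1 carry_comm_0[of a b c] by (auto simp: x tr_def)
  next
    case 2
    have "(a \<boxplus> c) \<boxplus> b = I" using 2 by (metis pl_assoc pl_commute top_pl)
    then show ?thesis using 2 carry_comm_1[of a b c] by (simp add: x tr_def)
  next
    case 3
    have "(a \<boxplus> b) \<boxplus> c = I" using 3 by (metis pl_assoc pl_commute top_pl)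
    then show ?thesis using 3 carry_comm_1[of a c b] by (simp add: x tr_def)
  next
    case 4
    have pr: "(a \<boxdot> b) \<boxdot> c = (a \<boxdot> c) \<boxdot> b" by (metis pr_assoc pr_commute)
    \<comment> \<open>If both orders carry twice, associativity of the product settles the claim.
      Otherwise one of the second additions does not overflow, so its product vanishes and the
      identity for two carries applies.\<close>
    have eq: "(a \<boxdot> b) \<boxplus> c = (a \<boxdot> c) \<boxplus> b" if "(a \<boxdot> b) \<boxplus> c \<noteq> I \<or> (a \<boxdot> c) \<boxplus> b \<noteq> I"
    proof (rule carry_comm_2)
      show "ng a \<sqsubseteq> b" "ng a \<sqsubseteq> c" using 4 by (simp_all add: pl_eq_top)
      have "x \<boxdot> y = z" if "x \<boxplus> y \<noteq> I" for x y
      proof -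
        have "x \<sqsubseteq> ng y" using that below_total[of "ng y" x] by (auto simp: pl_eq_top pl_commute[of x])
        then have "ng x \<boxplus> ng y = I" by (simp add: below_def)
        then show ?thesis by (simp add: pr_def)
      qed
      with that pr show "(a \<boxdot> b) \<boxdot> c = z" by metis
    qed
    show ?thesis
      using 4 eq pr by (cases "(a \<boxdot> b) \<boxplus> c = I"; cases "(a \<boxdot> c) \<boxplus> b = I") (auto simp: x tr_def)
  qed
qed

sublocale tr: comp_fun_commute tr
  by standard (simp add: fun_eq_iff tr_commute)

text \<open>The normalised pairs. Excluding \<open>I\<close> makes the carry count unique, and
  demanding representatives makes the lexicographic preorder antisymmetric.\<close>

definition line :: "(nat \<times> 'a) set" where "line = {(n, a). a \<noteq> I \<and> rp a = a}"

definition lex_le :: "nat \<times> 'a \<Rightarrow> nat \<times> 'a \<Rightarrow> bool" where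
  "lex_le x y \<longleftrightarrow> fst x < fst y \<or> fst x = fst y \<and> snd x \<sqsubseteq> snd y"

lemma lex_le_refl: "lex_le x x"
  by (simp add: lex_le_def below_refl)

lemma lex_le_trans: "lex_le x y \<Longrightarrow> lex_le y w \<Longrightarrow> lex_le x w"
  by (auto simp: lex_le_def intro: below_trans)

lemma lex_le_total: "lex_le x y \<or> lex_le y x"
  using below_total by (auto simp: lex_le_def)

lemma lex_le_antisym: "x \<in> line \<Longrightarrow> y \<in> line \<Longrightarrow> lex_le x y \<Longrightarrow> lex_le y x \<Longrightarrow> x = y"
  using below_antisym[of "snd x" "snd y"] by (auto simp: lex_le_def line_def)

lemma tr_line: "x \<in> line \<Longrightarrow> tr b x \<in> line"
  using pr_below[of "snd x" b] by (auto simp: line_def tr_def top_below split: if_splits)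

lemma tr_strict:
  assumes "x \<in> line" and "\<not> lex_le y x"
  shows "\<not> lex_le (tr b y) (tr b x)"
proof -
  obtain n a m a' where xy: "x = (n, a)" "y = (m, a')" by (cases x, cases y)
  have a: "rp a = a" "a \<noteq> I" using assms(1) by (auto simp: xy line_def)
  from assms(2) consider "n < m" | "n = m" "\<not> a' \<sqsubseteq> a"
    using linorder_less_linear[of n m] by (auto simp: xy lex_le_def)
  then show ?thesis
  proof cases
    case 1
    \<comment> \<open>The critical case is that only the smaller element carries and catches up in
      the first component. Then a + b - 1 < b, since \<open>a\<close> is not the top, while the
      other sum is at least \<open>b\<close>.\<close>
    have "\<not> a' \<boxplus> b \<sqsubseteq> a \<boxdot> b" if "a \<boxplus> b = I"
    proof
      assume "a' \<boxplus> b \<sqsubseteq> a \<boxdot> b"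
      then have "b \<sqsubseteq> a \<boxdot> b" using below_pl[of b a'] below_trans by (metis pl_commute)
      then have "b \<boxplus> ng b \<sqsubseteq> (a \<boxdot> b) \<boxplus> ng b" by (rule pl_mono)
      moreover have "(a \<boxdot> b) \<boxplus> ng b = a"
        using join_eq[of "ng b" a] that a by (simp add: pl_eq_top pl_commute[of a])
      ultimately show False using a compl[of b] by (simp add: pl_commute top_below)
    qed
    with 1 show ?thesis by (auto simp: xy lex_le_def tr_def)
  next
    case 2
    have "a \<sqsubseteq> a'" using 2 below_total by blast
    then have le: "a \<boxplus> b \<sqsubseteq> a' \<boxplus> b" by (rule pl_mono)
    then have "a \<boxplus> b = I \<Longrightarrow> a' \<boxplus> b = I" by (metis top_below rp_of_pl)
    then consider "a' \<boxplus> b \<noteq> I" "a \<boxplus> b \<noteq> I" | "a' \<boxplus> b = I" "a \<boxplus> b \<noteq> I" | "a' \<boxplus> b = I" "a \<boxplus> b = I"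
      by blast
    then show ?thesis
    proof cases
      case 1
      have "\<not> a' \<boxplus> b \<sqsubseteq> a \<boxplus> b"
      proof
        assume "a' \<boxplus> b \<sqsubseteq> a \<boxplus> b"
        then have "a' \<boxplus> b = a \<boxplus> b" using le below_antisym by fastforce
        moreover have "u \<sqsubseteq> ng b" if "u \<boxplus> b \<noteq> I" for u
          using that below_total[of u "ng b"] by (auto simp: pl_eq_top pl_commute[of u])
        \<comment> \<open>Without overflow \<open>b\<close> is cancelled by multiplying with its
          complement.\<close>
        ultimately have "rp a' = rp a"
          using 1 meet_eq[of a' "ng b"] meet_eq[of a "ng b"] by (simp add: pl_commute)
        then show False using \<open>\<not> a' \<sqsubseteq> a\<close> below_rp below_refl by metis
      qed
      with 1 2 show ?thesis by (auto simp: xy lex_le_def tr_def)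
    next
      case 2
      with \<open>n = m\<close> show ?thesis by (auto simp: xy lex_le_def tr_def)
    next
      case 3
      have "\<not> a' \<boxdot> b \<sqsubseteq> a \<boxdot> b"
      proof
        assume "a' \<boxdot> b \<sqsubseteq> a \<boxdot> b"
        then have "(a' \<boxdot> b) \<boxplus> ng b \<sqsubseteq> (a \<boxdot> b) \<boxplus> ng b" by (rule pl_mono)
        then show False
          using 3 \<open>\<not> a' \<sqsubseteq> a\<close> join_eq[of "ng b" a] join_eq[of "ng b" a']
          by (simp add: pl_eq_top pl_commute[of _ b])
      qed
      with 2 3 show ?thesis by (auto simp: xy lex_le_def tr_def)
    qed
  qed
qed

lemma tr_lex_le_iff:
  assumes "x \<in> line" and "y \<in> line"
  shows "lex_le (tr b x) (tr b y) \<longleftrightarrow> lex_le x y"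
proof
  assume "lex_le (tr b x) (tr b y)"
  then show "lex_le x y" using tr_strict[OF assms(2), of x b] by blast
next
  assume le: "lex_le x y"
  show "lex_le (tr b x) (tr b y)"
  proof (cases "lex_le y x")
    case True
    then have "x = y" using lex_le_antisym assms le by blast
    then show ?thesis by (simp add: lex_le_refl)
  next
    case False
    then show ?thesis using tr_strict[OF assms(1)] lex_le_total by blast
  qed
qed

section \<open>Multisets as an ordered monoid, and its real weights\<close>

definition msum :: "'a multiset \<Rightarrow> nat \<times> 'a" where "msum M = fold_mset tr (0, z) M"

lemma msum_empty [simp]: "msum {#} = (0, z)"
  by (simp add: msum_def)

lemma msum_add [simp]: "msum (add_mset a M) = tr a (msum M)"
  by (simp add: msum_def)

lemma msum_line: "msum M \<in> line"
proof (induction M)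
  case empty
  show ?case using nontrivial by (simp add: line_def)
qed (simp add: tr_line)

definition mle :: "'a multiset \<Rightarrow> 'a multiset \<Rightarrow> bool" where
  "mle M N \<longleftrightarrow> lex_le (msum M) (msum N)"

text \<open>Each translation \<open>tr\<close> is an order embedding on \<open>line\<close>.
  Cancellation is what makes the order depend on differences of multiplicities only.\<close>

lemma mle_cancel: "mle (K + M) (K + N) \<longleftrightarrow> mle M N"
  by (induction K) (simp_all add: mle_def tr_lex_le_iff msum_line)

lemma mle_add: "mle M N \<Longrightarrow> mle M' N' \<Longrightarrow> mle (M + M') (N + N')"
  by (metis mle_cancel mle_def lex_le_trans union_commute)

lemma mle_total: "mle M N \<or> mle N M"
  by (simp add: mle_def lex_le_total)

lemma mle_empty: "mle {#} M"
  by (auto simp: mle_def lex_le_def z_below)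

lemma tr_zero: "tr a (n, z) = (if rp a = I then (Suc n, z) else (n, rp a))"
proof -
  have "z \<boxdot> a = z" if "rp a = I"
    using that by (metis meet_eq pr_commute rp_pr(2) rp_z pl_top top_pl z_below z_pl)
  then show ?thesis by (simp add: tr_def)
qed

lemma mle_single_iff: "mle {#a#} {#b#} \<longleftrightarrow> a \<sqsubseteq> b"
proof -
  have "a \<sqsubseteq> b \<longleftrightarrow> rp b = I" if "rp a = I"
    using that below_rp(1)[of a b] by (simp add: top_below)
  moreover have "a \<sqsubseteq> b" if "rp b = I"
    using that below_rp(2)[of a b] by (simp add: below_top)
  ultimately show ?thesis
    by (auto simp: mle_def lex_le_def tr_zero below_refl)
qed

lemma not_mle_top_empty: "rp u = I \<Longrightarrow> \<not> mle {#u#} {#}"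
  by (simp add: mle_def lex_le_def tr_zero)

text \<open>The identity a + (1 - a) = 1. The members need only have the right representatives:
  weights are given to formulas such as \<open>Neg a\<close> and \<open>one\<close> themselves,
  which are not canonical.\<close>

lemma msum_compl: "rp b = ng a \<Longrightarrow> rp u = I \<Longrightarrow> msum {#a, b#} = msum {#u#}"
proof (cases "ng a = I")
  case True
  assume *: "rp b = ng a" "rp u = I"
  have "rp a = z" using True by (metis ng_ng rp_z)
  then show ?thesis using * True nontrivial by (simp add: tr_zero)
next
  case False
  assume *: "rp b = ng a" "rp u = I"
  have "ng a \<boxdot> a = z" using compl[of a] by (simp add: pr_def pl_commute)
  then show ?thesis using * False compl[of a] by (simp add: tr_zero) (simp add: tr_def)
qed

text \<open>The identity a + (a -> b) = b + 1 for \<open>b\<close> strictly below \<open>a\<close>: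
  the addition carries once and leaves the meet of \<open>a\<close> and \<open>b\<close>.\<close>

lemma msum_residual:
  assumes "\<not> a \<sqsubseteq> b" and "rp c = ng a \<boxplus> b" and "rp u = I"
  shows "msum {#a, c#} = msum {#b, u#}"
proof -
  have "b \<sqsubseteq> a" using assms(1) below_total by blast
  then have "(ng a \<boxplus> b) \<boxdot> a = rp b" using meet_eq[of b a] by (simp add: pr_commute)
  moreover have "rp b \<noteq> I" using assms(1) by (metis below_rp(2) below_top)
  moreover have "rp c \<noteq> I" using assms by (simp add: below_def)
  moreover have "(ng a \<boxplus> b) \<boxplus> a = I" by (metis compl pl_assoc pl_commute top_pl)
  ultimately show ?thesis using assms(2,3) by (simp add: tr_zero) (simp add: tr_def)
qed

text \<open>Differences of multiplicities form a cone \<open>P\<close> of integer functions, well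
  defined by cancellation. Strict and weak comparisons within \<open>B\<close> are the inequalities
  handed to Fourier-Motzkin. Finiteness of \<open>B\<close> is essential: infinitesimals exclude one
  real weight for all multisets.\<close>

lemma ex_real_weight:
  assumes "finite B"
  shows "\<exists>w :: 'a \<Rightarrow> real. \<forall>M\<in>B. \<forall>N\<in>B. mle M N \<longleftrightarrow> (\<Sum>x\<in>#M. w x) \<le> (\<Sum>x\<in>#N. w x)"
proof -
  define dif where "dif = (\<lambda>(M, N) (x::'a). int (count N x) - int (count M x))"
  define P where "P f \<longleftrightarrow> (\<exists>M N. mle M N \<and> f = dif (M, N))" for f
  have P_iff: "P (dif (M, N)) \<longleftrightarrow> mle M N" for M N
  proof
    assume "P (dif (M, N))"
    then obtain M' N' where M': "mle M' N'" and eq: "dif (M, N) = dif (M', N')" by (auto simp: P_def)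
    have "M + N' = M' + N"
    proof (rule multiset_eqI)
      fix x
      have "dif (M, N) x = dif (M', N') x" by (simp add: eq)
      then show "count (M + N') x = count (M' + N) x" by (simp add: dif_def)
    qed
    then have "mle (M' + M) (M' + N)"
      using M' mle_cancel[of M M' N'] by (simp add: union_commute)
    then show "mle M N" by (simp add: mle_cancel)
  qed (auto simp: P_def)
  define F where "F = (\<Union>M\<in>B. set_mset M)"
  define D where "D = dif ` {(M, N) \<in> B \<times> B. \<not> mle N M}"
  define E where "E = dif ` {(M, N) \<in> B \<times> B. mle M N}"
  have "\<exists>w :: 'a \<Rightarrow> real. (\<forall>f\<in>D. (\<Sum>x\<in>F. w x * of_int (f x)) > 0) \<and>
           (\<forall>f\<in>E. (\<Sum>x\<in>F. w x * of_int (f x)) \<ge> 0)"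
  proof (rule fourier_motzkin[of P])
    show "P (\<lambda>x. f x + g x)" if "P f" "P g" for f g
    proof -
      from that obtain M N M' N'
        where "mle M N" "f = dif (M, N)" "mle M' N'" "g = dif (M', N')"
        by (auto simp: P_def)
      then have "mle (M + M') (N + N')" "(\<lambda>x. f x + g x) = dif (M + M', N + N')"
        by (auto simp: mle_add dif_def)
      then show ?thesis by (auto simp: P_def)
    qed
    show "finite F" using assms by (simp add: F_def)
    have "finite (B \<times> B)" using assms by simp
    then show "finite D" "finite E"
      unfolding D_def E_def by (auto intro!: finite_imageI elim: rev_finite_subset)
    show "P f \<and> \<not> P (\<lambda>x. - f x)" if "f \<in> D" for f
    proof -
      from that obtain M N where f: "f = dif (M, N)" "\<not> mle N M" by (auto simp: D_def)
      moreover have "(\<lambda>x. - f x) = dif (N, M)" by (auto simp: f dif_def)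
      ultimately show ?thesis using mle_total[of M N] by (simp add: P_iff)
    qed
    show "P f" if "f \<in> E" for f using that by (auto simp: E_def P_iff)
    show "f x = 0" if "f \<in> D \<union> E" "x \<notin> F" for f x
    proof -
      from that(1) obtain M N where "M \<in> B" "N \<in> B" "f = dif (M, N)"
        by (auto simp: D_def E_def)
      with that(2) show ?thesis by (auto simp: F_def dif_def not_in_iff)
    qed
  qed
  then obtain w :: "'a \<Rightarrow> real" where
    wD: "\<forall>f\<in>D. (\<Sum>x\<in>F. w x * of_int (f x)) > 0" and
    wE: "\<forall>f\<in>E. (\<Sum>x\<in>F. w x * of_int (f x)) \<ge> 0" by (elim exE conjE)
  have finF: "finite F" using assms by (simp add: F_def)
  have sum: "(\<Sum>x\<in>#M. w x) = (\<Sum>x\<in>F. w x * real (count M x))" if "set_mset M \<subseteq> F" for M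
    using that
  proof (induction M)
    case (add a M)
    have "(\<Sum>x\<in>F. w x * real (count (add_mset a M) x)) =
        (\<Sum>x\<in>F. w x * real (count M x) + (if x = a then w x else 0))"
      by (intro sum.cong) (auto simp: algebra_simps)
    then show ?case using add finF by (simp add: sum.distrib)
  qed simp
  have dif: "(\<Sum>x\<in>F. w x * of_int (dif (M, N) x)) = (\<Sum>x\<in>#N. w x) - (\<Sum>x\<in>#M. w x)"
    if "M \<in> B" "N \<in> B" for M N
  proof -
    have "set_mset M \<subseteq> F" "set_mset N \<subseteq> F" using that by (auto simp: F_def)
    then show ?thesis
      by (simp add: sum dif_def right_diff_distrib sum_subtractf)
  qed
  have "mle M N \<longleftrightarrow> (\<Sum>x\<in>#M. w x) \<le> (\<Sum>x\<in>#N. w x)" if "M \<in> B" "N \<in> B" for M N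
  proof
    assume "mle M N"
    then have "dif (M, N) \<in> E" using that by (auto simp: E_def)
    then show "(\<Sum>x\<in>#M. w x) \<le> (\<Sum>x\<in>#N. w x)" using wE dif[OF that] by fastforce
  next
    assume le: "(\<Sum>x\<in>#M. w x) \<le> (\<Sum>x\<in>#N. w x)"
    show "mle M N"
    proof (rule ccontr)
      assume "\<not> mle M N"
      then have "dif (N, M) \<in> D" using that by (auto simp: D_def)
      then show False using wD dif[OF that(2,1)] le by fastforce
    qed
  qed
  then show ?thesis by blast
qed

end

section \<open>Real valuations for finitely many formulas of a prime theory\<close>

lemma luk_eval_cong: "(\<And>x. x \<in> vars \<phi> \<Longrightarrow> v x = v' x) \<Longrightarrow> luk_eval v \<phi> = luk_eval v' \<phi>"
  by (induction \<phi>) auto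

lemma finite_bounded_size:
  assumes "finite H"
  shows "finite {\<phi> :: 'x luk_form. vars \<phi> \<subseteq> H \<and> size \<phi> \<le> k}"
proof (induction k)
  case 0
  have "{\<phi>. vars \<phi> \<subseteq> H \<and> size \<phi> \<le> 0} \<subseteq> Var ` H"
  proof
    fix \<phi> assume "\<phi> \<in> {\<phi>. vars \<phi> \<subseteq> H \<and> size \<phi> \<le> 0}"
    then show "\<phi> \<in> Var ` H" by (cases \<phi>) auto
  qed
  then show ?case using assms by (auto intro: finite_subset)
next
  case (Suc k)
  let ?F = "{\<phi> :: 'x luk_form. vars \<phi> \<subseteq> H \<and> size \<phi> \<le> k}"
  have "{\<phi>. vars \<phi> \<subseteq> H \<and> size \<phi> \<le> Suc k} \<subseteq> Var ` H \<union> Neg ` ?F \<union> (\<lambda>(a, b). Imp a b) ` (?F \<times> ?F)"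
  proof
    fix \<phi> assume "\<phi> \<in> {\<phi>. vars \<phi> \<subseteq> H \<and> size \<phi> \<le> Suc k}"
    then show "\<phi> \<in> Var ` H \<union> Neg ` ?F \<union> (\<lambda>(a, b). Imp a b) ` (?F \<times> ?F)"
      by (cases \<phi>) auto
  qed
  moreover have "finite (Var ` H \<union> Neg ` ?F \<union> (\<lambda>(a, b). Imp a b) ` (?F \<times> ?F))"
    using assms Suc.IH by blast
  ultimately show ?case by (rule finite_subset)
qed

locale luk_prime = luk_theory +
  assumes linear: "Imp a b \<in> T \<or> Imp b a \<in> T"
    and proper: "T \<noteq> UNIV"
begin

lemma Oplus_cong: "a \<doteq> a' \<Longrightarrow> b \<doteq> b' \<Longrightarrow> Oplus a b \<doteq> Oplus a' b'"
  unfolding Oplus_def by (intro Imp_cong Neg_cong)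

lemma Oplus_commute: "Oplus a b \<doteq> Oplus b a"
  unfolding Oplus_def
  by (rule eqv_trans[OF contrap_eqv Imp_cong[OF eqv_refl Neg_Neg]])

lemma Oplus_assoc: "Oplus (Oplus a b) c \<doteq> Oplus a (Oplus b c)"
proof -
  have "Oplus (Oplus a b) c \<doteq> Oplus c (Oplus a b)" by (rule Oplus_commute)
  also have "\<dots> \<doteq> Oplus a (Oplus c b)" unfolding Oplus_def by (rule exchange_eqv)
  also have "\<dots> \<doteq> Oplus a (Oplus b c)" by (intro Oplus_cong eqv_refl Oplus_commute)
  finally show ?thesis .
qed

lemma rep_simps:
  "rep (rep a) = rep a" "rep (Neg (rep a)) = rep (Neg a)"
  "rep (Oplus (rep a) b) = rep (Oplus a b)" "rep (Oplus a (rep b)) = rep (Oplus a b)"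
  by (simp_all add: rep_eq_iff Neg_cong Oplus_cong eqv_rep eqv_refl eqv_sym)

lemma Imp_Neg_Neg: "Oplus (Neg a) b \<doteq> Imp a b"
  unfolding Oplus_def by (intro Imp_cong Neg_Neg eqv_refl)

lemma Neg_zero: "Neg zero \<doteq> one"
  unfolding zero_def by (rule Neg_Neg)

lemma rep_top_iff: "rep a = rep (Neg zero) \<longleftrightarrow> a \<in> T"
  by (meson Neg_zero eqv_one_iff eqv_sym eqv_trans rep_eq_iff)

lemma Oplus_zero: "Oplus a zero \<doteq> a"
  unfolding Oplus_def by (rule eqv_trans[OF eqv_sym[OF Neg_eqv] Neg_Neg])

lemma Oplus_Neg_zero: "Oplus a (Neg zero) \<in> T"
  unfolding Oplus_def using Neg_zero by (simp add: eqv_one_iff top_le)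

lemma Oplus_join: "Oplus (Neg (Oplus (Neg a) b)) b \<doteq> Imp (Imp a b) b"
  by (rule eqv_trans[OF Imp_Neg_Neg Imp_cong[OF Imp_Neg_Neg eqv_refl]])

lemma zero_notin: "zero \<notin> T"
  using proper zero_le mp by blast

text \<open>The Lindenbaum algebra, living on formulas through \<open>rep\<close>;
  \<open>linear\<close> makes it a chain and \<open>proper\<close> makes it nontrivial.\<close>

sublocale mv: mv_chain rep "\<lambda>a. rep (Neg a)" "\<lambda>a b. rep (Oplus a b)" "rep zero"
proof
  show "rep (Oplus (rep (Oplus a b)) c) = rep (Oplus a (rep (Oplus b c)))" for a b c
    by (simp add: rep_simps) (simp add: rep_eq_iff Oplus_assoc)
  show "rep (Oplus (rep (Neg (rep (Oplus (rep (Neg a)) b)))) b) =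
      rep (Oplus (rep (Neg (rep (Oplus (rep (Neg b)) a)))) a)" for a b
    by (simp add: rep_simps)
       (simp add: rep_eq_iff eqv_trans[OF Oplus_join eqv_trans[OF join_comm_eqv eqv_sym[OF Oplus_join]]])
  show "rep (Oplus (rep (Neg a)) b) = rep (Neg (rep zero)) \<or>
      rep (Oplus (rep (Neg b)) a) = rep (Neg (rep zero))" for a b
  proof -
    have "rep (Oplus (Neg a) b) = rep (Imp a b)" for a b
      by (simp add: rep_eq_iff Imp_Neg_Neg)
    with linear[of a b] show ?thesis by (simp add: rep_simps rep_top_iff)
  qed
  show "rep (Neg (rep zero)) \<noteq> rep zero"
    using zero_notin rep_top_iff[of zero] by (auto simp: rep_simps)
qed (simp_all add: rep_simps, simp_all add: rep_eq_iff Oplus_commute Oplus_zero Neg_Neg,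
  simp add: rep_top_iff Oplus_Neg_zero flip: rep_eq_iff)

lemma below_iff: "mv.below a b \<longleftrightarrow> Imp a b \<in> T"
proof -
  have "rep (Oplus (Neg a) b) = rep (Imp a b)" by (simp add: rep_eq_iff Imp_Neg_Neg)
  then show ?thesis by (simp add: mv.below_def rep_simps rep_top_iff)
qed

text \<open>A real weight respecting the order also respects the equations for negation and
  implication, as each is an equality of multiset sums. Divided by the weight of \<open>one\<close>,
  it is a truth valuation on \<open>F\<close>.\<close>

lemma ex_valuation:
  assumes "finite F" and NegF: "\<And>a. Neg a \<in> F \<Longrightarrow> a \<in> F"
    and ImpF: "\<And>a b. Imp a b \<in> F \<Longrightarrow> a \<in> F \<and> b \<in> F"
  shows "\<exists>v. \<forall>\<phi>\<in>F. luk_eval v \<phi> \<in> {0..1} \<and> (luk_eval v \<phi> = 1 \<longleftrightarrow> \<phi> \<in> T)"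
proof -
  define G where "G = insert one F"
  \<comment> \<open>The equations for \<open>Neg\<close> and \<open>Imp\<close> have at most two
    summands on each side; the empty multiset is compared with \<open>one\<close> and with single
    formulas to get signs.\<close>
  define B where "B = insert {#} ((\<lambda>a. {#a#}) ` G \<union> (\<lambda>(a, b). {#a, b#}) ` (G \<times> G))"
  have "finite B" using assms(1) by (simp add: B_def G_def)
  from mv.ex_real_weight[OF this] obtain w :: "_ \<Rightarrow> real" where
    "\<forall>M\<in>B. \<forall>N\<in>B. mv.mle M N \<longleftrightarrow> (\<Sum>x\<in>#M. w x) \<le> (\<Sum>x\<in>#N. w x)" by (elim exE)
  then have w: "mv.mle M N \<longleftrightarrow> (\<Sum>x\<in>#M. w x) \<le> (\<Sum>x\<in>#N. w x)" if "M \<in> B" "N \<in> B" for M N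
    using that by simp
  have B: "{#} \<in> B" "a \<in> G \<Longrightarrow> {#a#} \<in> B" "a \<in> G \<Longrightarrow> b \<in> G \<Longrightarrow> {#a, b#} \<in> B" for a b
    by (auto simp: B_def)
  have G: "one \<in> G" "a \<in> F \<Longrightarrow> a \<in> G" for a by (auto simp: G_def)
  have w_eq: "(\<Sum>x\<in>#M. w x) = (\<Sum>x\<in>#N. w x)" if "M \<in> B" "N \<in> B" "mv.msum M = mv.msum N" for M N
    using that w[of M N] w[of N M] by (simp add: mv.mle_def mv.lex_le_refl)
  have top: "rep one = rep (Neg (rep zero))" by (simp add: rep_simps rep_top_iff one_in)
  have pos: "w one > 0"
    using w[of "{#one#}" "{#}"] mv.not_mle_top_empty[OF top] B G by simp
  have ge: "w a \<ge> 0" if "a \<in> F" for a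
    using w[of "{#}" "{#a#}"] mv.mle_empty B G that by simp
  have le_iff: "w a \<le> w b \<longleftrightarrow> Imp a b \<in> T" if "a \<in> G" "b \<in> G" for a b
    using w[of "{#a#}" "{#b#}"] B that by (simp add: mv.mle_single_iff below_iff)
  have le: "w a \<le> w one" if "a \<in> F" for a
    using le_iff[of a one] G that by (simp add: top_le one_in)
  have eq_iff: "w a = w one \<longleftrightarrow> a \<in> T" if "a \<in> F" for a
    using le_iff[of one a] le[OF that] G that by (metis antisym_conv mp one_in top_le)
  have wNeg: "w (Neg a) = w one - w a" if "Neg a \<in> F" for a
    using w_eq[OF _ _ mv.msum_compl[OF _ top, of "Neg a" a]] that NegF[OF that] B G by simp
  have wImp: "w (Imp a b) = min (w one) (w one - w a + w b)" if "Imp a b \<in> F" for a b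
  proof (cases "Imp a b \<in> T")
    case True
    then show ?thesis using eq_iff[OF that] le_iff[of a b] ImpF[OF that] G by simp
  next
    case False
    have "rep (Imp a b) = rep (Oplus (rep (Neg a)) b)"
      by (simp add: rep_simps) (simp add: rep_eq_iff eqv_sym Imp_Neg_Neg)
    then have "mv.msum {#a, Imp a b#} = mv.msum {#b, one#}"
      using mv.msum_residual[OF _ _ top] False by (simp add: below_iff)
    from w_eq[OF _ _ this] have "w a + w (Imp a b) = w b + w one"
      using ImpF[OF that] that B G by simp
    moreover have "\<not> w a \<le> w b" using False le_iff[of a b] ImpF[OF that] G by simp
    ultimately show ?thesis by simp
  qed
  define v where "v = (\<lambda>x. w (Var x) / w one)"
  have ev: "luk_eval v \<phi> = w \<phi> / w one" if "\<phi> \<in> F" for \<phi>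
    using that
  proof (induction \<phi>)
    case (Neg \<phi>)
    then show ?case using NegF[OF Neg.prems] wNeg[OF Neg.prems] pos
      by (simp add: mv_neg_def diff_divide_distrib)
  next
    case (Imp \<phi> \<psi>)
    have "min 1 (1 - w \<phi> / w one + w \<psi> / w one) = min (w one) (w one - w \<phi> + w \<psi>) / w one"
      using pos by (simp add: min_def field_simps)
    then show ?case
      using Imp.IH ImpF[OF Imp.prems] wImp[OF Imp.prems]
      by (simp add: mv_neg_def mv_oplus_def)
  qed (simp add: v_def)
  have "luk_eval v \<phi> \<in> {0..1} \<and> (luk_eval v \<phi> = 1 \<longleftrightarrow> \<phi> \<in> T)" if "\<phi> \<in> F" for \<phi>
    using pos ge[OF that] le[OF that] eq_iff[OF that] by (auto simp: ev[OF that])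
  then show ?thesis by (intro exI[of _ v] ballI)
qed

text \<open>Only finitely many formulas over \<open>H\<close> have size at most \<open>k\<close>, so
  for each \<open>k\<close> one point decides all of them correctly.\<close>

lemma ex_valuation_sequence:
  assumes "finite H"
  shows "\<exists>p. \<forall>k. p k \<in> cube H \<and>
    (\<forall>\<phi>. vars \<phi> \<subseteq> H \<longrightarrow> size \<phi> \<le> k \<longrightarrow> (luk_eval (p k) \<phi> = 1 \<longleftrightarrow> \<phi> \<in> T))"
proof (rule choice, rule allI)
  fix k
  define F where "F = {\<phi> :: 'a luk_form. vars \<phi> \<subseteq> H \<and> size \<phi> \<le> Suc k}"
  have "\<exists>v. \<forall>\<phi>\<in>F. luk_eval v \<phi> \<in> {0..1} \<and> (luk_eval v \<phi> = 1 \<longleftrightarrow> \<phi> \<in> T)"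
    by (rule ex_valuation) (use finite_bounded_size[OF assms] in \<open>auto simp: F_def\<close>)
  then obtain v where v: "\<And>\<phi>. \<phi> \<in> F \<Longrightarrow> luk_eval v \<phi> \<in> {0..1} \<and> (luk_eval v \<phi> = 1 \<longleftrightarrow> \<phi> \<in> T)"
    by blast
  have "restrict v H \<in> cube H"
    using v[of "Var _"] by (auto simp: cube_def F_def)
  moreover have "luk_eval (restrict v H) \<phi> = luk_eval v \<phi>" if "vars \<phi> \<subseteq> H" for \<phi>
    using that by (intro luk_eval_cong) auto
  ultimately show "\<exists>p. p \<in> cube H \<and>
      (\<forall>\<phi>. vars \<phi> \<subseteq> H \<longrightarrow> size \<phi> \<le> k \<longrightarrow> (luk_eval p \<phi> = 1 \<longleftrightarrow> \<phi> \<in> T))"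
    using v by (intro exI[of _ "restrict v H"]) (simp add: F_def)
qed

end

section \<open>Tangent directions of a sequence\<close>

lemma bounded_subsequence:
  fixes f :: "nat \<Rightarrow> 'x \<Rightarrow> real"
  assumes "finite H" and "\<And>k x. x \<in> H \<Longrightarrow> \<bar>f k x\<bar> \<le> B"
  obtains l r where "strict_mono r" and "\<And>x. x \<in> H \<Longrightarrow> (\<lambda>k. f (r k) x) \<longlonglongrightarrow> l x"
proof -
  have "\<exists>l r. strict_mono r \<and> (\<forall>x\<in>H. (\<lambda>k. f (r k) x) \<longlonglongrightarrow> l x)"
    using assms
  proof (induction H rule: finite_induct)
    case empty
    show ?case by (rule exI, rule exI[of _ id]) (simp add: strict_mono_def)
  next
    case (insert y H)
    have "\<exists>l r. strict_mono r \<and> (\<forall>x\<in>H. (\<lambda>k. f (r k) x) \<longlonglongrightarrow> l x)"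
      by (rule insert.IH) (use insert.prems in auto)
    then obtain l r where r: "strict_mono (r :: nat \<Rightarrow> nat)"
      and l: "\<forall>x\<in>H. (\<lambda>k. f (r k) x) \<longlonglongrightarrow> l x" by blast
    have "bounded (range (\<lambda>k. f (r k) y))"
      by (rule boundedI[of _ B]) (use insert.prems[of y] in auto)
    then obtain b s where s: "strict_mono (s :: nat \<Rightarrow> nat)" and b: "((\<lambda>k. f (r k) y) \<circ> s) \<longlonglongrightarrow> b"
      using bounded_imp_convergent_subsequence by metis
    have "(\<lambda>k. f ((r \<circ> s) k) x) \<longlonglongrightarrow> (l(y := b)) x" if "x \<in> insert y H" for x
    proof (cases "x = y")
      case True
      with b show ?thesis by (simp add: o_def)
    next
      case False
      with that l have "(\<lambda>k. f (r k) x) \<longlonglongrightarrow> l x" by simp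
      from LIMSEQ_subseq_LIMSEQ[OF this s] False show ?thesis by (simp add: o_def)
    qed
    moreover have "strict_mono (r \<circ> s)" using r s by (rule strict_mono_o)
    ultimately show ?case by blast
  qed
  then obtain l r where "strict_mono r \<and> (\<forall>x\<in>H. (\<lambda>k. f (r k) x) \<longlonglongrightarrow> l x)" by (elim exE)
  then show thesis by (intro that[of r l]) auto
qed

section \<open>Orthonormal systems and tangent flags\<close>

definition ip :: "'x set \<Rightarrow> ('x \<Rightarrow> real) \<Rightarrow> ('x \<Rightarrow> real) \<Rightarrow> real" where
  "ip H u v = (\<Sum>x\<in>H. u x * v x)"

lemma ip_L2: "ip H u u = (L2_set u H)\<^sup>2"
  by (simp add: ip_def L2_set_def sum_nonneg power2_eq_square)

lemma ip_commute: "ip H u v = ip H v u"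
  by (simp add: ip_def mult.commute)

lemma ip_diff: "ip H (\<lambda>x. u x - c * v x) w = ip H u w - c * ip H v w"
  by (simp add: ip_def left_diff_distrib sum_subtractf sum_distrib_left mult.assoc)

lemma ip_scale: "ip H (\<lambda>x. u x / c) v = ip H u v / c"
  by (simp add: ip_def sum_divide_distrib)

lemma tendsto_ip:
  assumes "\<And>x. x \<in> H \<Longrightarrow> (\<lambda>k. f k x) \<longlonglongrightarrow> l x" and "\<And>x. x \<in> H \<Longrightarrow> (\<lambda>k. g k x) \<longlonglongrightarrow> m x"
  shows "(\<lambda>k. ip H (f k) (g k)) \<longlonglongrightarrow> ip H l m"
  unfolding ip_def using assms by (intro tendsto_sum tendsto_mult)

text \<open>Bessel's inequality for the standard basis vectors, summed over the basis.\<close>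

lemma orthonormal_card_le:
  assumes "finite H" and "finite J"
    and "\<And>i j. i \<in> J \<Longrightarrow> j \<in> J \<Longrightarrow> ip H (u i) (u j) = (if i = j then 1 else 0)"
  shows "card J \<le> card H"
proof -
  have le: "(\<Sum>i\<in>J. (u i x)\<^sup>2) \<le> 1" if x: "x \<in> H" for x
  proof -
    \<comment> \<open>The orthogonal projection of the basis vector at \<open>x\<close> to the span
      of the \<open>u i\<close>. Its squared norm is \<open>s x\<close>, so its distance from the
      basis vector has square \<open>1 - s x\<close>.\<close>
    define s where "s y = (\<Sum>i\<in>J. u i x * u i y)" for y
    have sx: "s x = (\<Sum>i\<in>J. (u i x)\<^sup>2)" by (simp add: s_def power2_eq_square)
    have "(\<Sum>y\<in>H. s y * s y) = (\<Sum>y\<in>H. \<Sum>i\<in>J. \<Sum>j\<in>J. u i x * u j x * (u i y * u j y))"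
      by (simp add: s_def sum_product mult_ac)
    also have "\<dots> = (\<Sum>i\<in>J. \<Sum>y\<in>H. \<Sum>j\<in>J. u i x * u j x * (u i y * u j y))"
      by (rule sum.swap)
    also have "\<dots> = (\<Sum>i\<in>J. \<Sum>j\<in>J. \<Sum>y\<in>H. u i x * u j x * (u i y * u j y))"
      by (intro sum.cong refl sum.swap)
    also have "\<dots> = (\<Sum>i\<in>J. \<Sum>j\<in>J. u i x * u j x * ip H (u i) (u j))"
      by (simp add: ip_def sum_distrib_left)
    also have "\<dots> = (\<Sum>i\<in>J. \<Sum>j\<in>J. if i = j then u i x * u j x else 0)"
      by (intro sum.cong refl) (simp add: assms(3))
    also have "\<dots> = s x" using assms(2) by (simp add: s_def)
    finally have ss: "(\<Sum>y\<in>H. s y * s y) = s x" .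
    have "0 \<le> (\<Sum>y\<in>H. ((if y = x then 1 else 0) - s y)\<^sup>2)" by (simp add: sum_nonneg)
    also have "\<dots> = (\<Sum>y\<in>H. (if y = x then 1 - 2 * s y else 0) + s y * s y)"
      by (intro sum.cong) (auto simp: power2_eq_square algebra_simps)
    also have "\<dots> = 1 - s x" using assms(1) x ss by (simp add: sum.distrib)
    finally show ?thesis by (simp add: sx)
  qed
  have "real (card J) = (\<Sum>i\<in>J. ip H (u i) (u i))" by (simp add: assms(3))
  also have "\<dots> = (\<Sum>x\<in>H. \<Sum>i\<in>J. (u i x)\<^sup>2)"
    unfolding ip_def power2_eq_square by (rule sum.swap)
  also have "\<dots> \<le> (\<Sum>x\<in>H. 1)" by (intro sum_mono le)
  finally show ?thesis by simp
qed

text \<open>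
  The first \<open>n\<close> Bouligand--Severi tangent directions of a sequence \<open>p\<close>: along the subsequence \<open>r\<close>,
  \<open>p = \<Sum>\<^sub>j a\<^sub>j u\<^sub>j + q\<close> with \<open>a\<^sub>0 = 1\<close>, each coefficient infinitesimal relative to the previous one, and
  remainder \<open>q\<close> orthogonal to \<open>u\<^sub>1, \<dots>, u\<^sub>n\<close> and infinitesimal relative to the last coefficient.
\<close>

definition tangent_flag ::
    "'x set \<Rightarrow> (nat \<Rightarrow> 'x \<Rightarrow> real) \<Rightarrow> nat \<Rightarrow> (nat \<Rightarrow> 'x \<Rightarrow> real) \<Rightarrow> (nat \<Rightarrow> nat \<Rightarrow> real) \<Rightarrow>
     (nat \<Rightarrow> nat) \<Rightarrow> (nat \<Rightarrow> 'x \<Rightarrow> real) \<Rightarrow> bool" where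
  "tangent_flag H p n u a r q \<longleftrightarrow> strict_mono r \<and>
     (\<forall>i\<in>{1..n}. \<forall>j\<in>{1..n}. ip H (u i) (u j) = (if i = j then 1 else 0)) \<and>
     (\<forall>k. a 0 k = 1) \<and> (\<forall>j\<le>n. \<forall>k. a j k > 0) \<and>
     (\<forall>j<n. (\<lambda>k. a (Suc j) k / a j k) \<longlonglongrightarrow> 0) \<and>
     (\<forall>k. \<forall>i\<in>{1..n}. ip H (q k) (u i) = 0) \<and>
     (\<lambda>k. L2_set (q k) H / a n k) \<longlonglongrightarrow> 0 \<and>
     (\<forall>k. \<forall>x\<in>H. p (r k) x = (\<Sum>j\<le>n. a j k * u j x) + q k x)"

lemma tangent_flag_subseq:
  assumes "tangent_flag H p n u a r q" and "strict_mono s"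
  shows "tangent_flag H p n u (\<lambda>j k. a j (s k)) (\<lambda>k. r (s k)) (\<lambda>k. q (s k))"
proof -
  have sub: "(\<lambda>k. f (s k)) \<longlonglongrightarrow> L" if "f \<longlonglongrightarrow> L" for f :: "nat \<Rightarrow> real" and L
    using LIMSEQ_subseq_LIMSEQ[OF that assms(2)] by (simp add: o_def)
  have "(\<lambda>k. a (Suc j) (s k) / a j (s k)) \<longlonglongrightarrow> 0" if "j < n" for j
    using sub[of "\<lambda>k. a (Suc j) k / a j k" 0] assms(1) that by (simp add: tangent_flag_def)
  moreover have "(\<lambda>k. L2_set (q (s k)) H / a n (s k)) \<longlonglongrightarrow> 0"
    using sub[of "\<lambda>k. L2_set (q k) H / a n k" 0] assms(1) by (simp add: tangent_flag_def)
  moreover have "strict_mono (\<lambda>k. r (s k))"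
    using strict_mono_o[of r s] assms by (simp add: tangent_flag_def o_def)
  ultimately show ?thesis using assms(1) unfolding tangent_flag_def by simp
qed

lemma tangent_flag_0:
  assumes "finite H" and "\<And>k x. x \<in> H \<Longrightarrow> \<bar>p k x\<bar> \<le> B"
  shows "\<exists>u a r q. tangent_flag H p 0 u a r q"
proof -
  obtain l r where r: "strict_mono r" and l: "\<And>x. x \<in> H \<Longrightarrow> (\<lambda>k. p (r k) x) \<longlonglongrightarrow> l x"
    using bounded_subsequence[of H p B] assms by metis
  define q where "q k x = p (r k) x - l x" for k x
  have "(\<lambda>k. q k x) \<longlonglongrightarrow> 0" if "x \<in> H" for x
    unfolding q_def using l[OF that] LIM_zero by blast
  then have "(\<lambda>k. sqrt (ip H (q k) (q k))) \<longlonglongrightarrow> sqrt (ip H (\<lambda>x. 0) (\<lambda>x. 0))"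
    by (intro tendsto_real_sqrt tendsto_ip)
  then have "(\<lambda>k. L2_set (q k) H) \<longlonglongrightarrow> 0"
    by (simp add: ip_L2) (simp add: L2_set_def)
  then have "tangent_flag H p 0 (\<lambda>_. l) (\<lambda>_ _. 1) r q"
    using r by (simp add: tangent_flag_def q_def)
  then show ?thesis by blast
qed

text \<open>The new direction \<open>l\<close> is a limit of the normalised remainders, hence a unit
  vector orthogonal to the old ones. Its coefficient \<open>c\<close> is the projection of the
  remainder to \<open>l\<close> rather than its norm, which keeps the new remainder exactly
  orthogonal to \<open>l\<close>.\<close>

lemma tangent_flag_Suc:
  assumes "finite H" and flag: "tangent_flag H p n u a r q"
    and ne: "\<And>k. L2_set (q k) H > 0"
  shows "\<exists>u a r q. tangent_flag H p (Suc n) u a r q"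
proof -
  have [simp]: "L2_set (q k) H \<noteq> 0" for k using ne[of k] by simp
  define e where "e k x = q k x / L2_set (q k) H" for k x
  have ip_e: "ip H (e k) v = ip H (q k) v / L2_set (q k) H" for k v
    unfolding e_def by (rule ip_scale)
  have e_le: "\<bar>e k x\<bar> \<le> 1" if "x \<in> H" for k x
    using member_le_L2_set[OF assms(1) that, of "\<lambda>x. \<bar>q k x\<bar>"] ne[of k]
    by (simp add: e_def L2_set_def)
  obtain l s where s: "strict_mono s" and l: "\<And>x. x \<in> H \<Longrightarrow> (\<lambda>k. e (s k) x) \<longlonglongrightarrow> l x"
    using bounded_subsequence[of H e 1] assms(1) e_le by metis
  have "ip H (e k) (e k) = 1" for k
    unfolding ip_e ip_commute[of H "q k" "e k"]
    using ne[of k] by (simp add: ip_L2 power2_eq_square)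
  moreover have "(\<lambda>k. ip H (e (s k)) (e (s k))) \<longlonglongrightarrow> ip H l l"
    by (rule tendsto_ip[OF l l])
  ultimately have ll: "ip H l l = 1" by (simp add: LIMSEQ_const_iff)
  have lu: "ip H l (u i) = 0" if "i \<in> {1..n}" for i
  proof -
    have "ip H (e (s k)) (u i) = 0" for k
      using flag that by (simp add: ip_e tangent_flag_def)
    moreover have "(\<lambda>k. ip H (e (s k)) (u i)) \<longlonglongrightarrow> ip H l (u i)"
      by (rule tendsto_ip[OF l tendsto_const])
    ultimately show ?thesis by (simp add: LIMSEQ_const_iff)
  qed
  define c where "c k = ip H (q k) l" for k
  have "(\<lambda>k. ip H (e (s k)) l) \<longlonglongrightarrow> ip H l l"
    by (rule tendsto_ip[OF l tendsto_const])
  then have c1: "(\<lambda>k. c (s k) / L2_set (q (s k)) H) \<longlonglongrightarrow> 1"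
    by (simp add: ll c_def ip_e)
  then have "\<forall>\<^sub>F k in sequentially. 0 < c (s k) / L2_set (q (s k)) H"
    by (rule order_tendstoD) simp
  \<comment> \<open>Positivity is required at every index but holds only eventually; the subsequence
    \<open>t\<close> omits the first \<open>N\<close> terms.\<close>
  then obtain N where N: "\<And>k. k \<ge> N \<Longrightarrow> 0 < c (s k) / L2_set (q (s k)) H"
    by (auto simp: eventually_sequentially)
  define t where "t k = s (k + N)" for k
  have t: "strict_mono t" using s by (simp add: t_def strict_mono_def)
  have c_pos: "c (t k) > 0" for k
    using N[of "k + N"] ne[of "t k"] by (simp add: t_def zero_less_divide_iff)
  have ct: "(\<lambda>k. c (t k) / L2_set (q (t k)) H) \<longlonglongrightarrow> 1"
    unfolding t_def using c1 by (rule LIMSEQ_ignore_initial_segment)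
  note flag' = tangent_flag_subseq[OF flag t]
  define u' where "u' = u(Suc n := l)"
  define a' where "a' j k = (if j = Suc n then c (t k) else a j (t k))" for j k
  define q' where "q' k x = q (t k) x - c (t k) * l x" for k x
  have ip_q': "ip H (q' k) w = ip H (q (t k)) w - c (t k) * ip H l w" for k w
    unfolding q'_def by (rule ip_diff)
  have orth: "ip H (u' i) (u' j) = (if i = j then 1 else 0)" if "i \<in> {1..Suc n}" "j \<in> {1..Suc n}" for i j
  proof -
    have "i \<in> {1..n} \<or> i = Suc n" "j \<in> {1..n} \<or> j = Suc n" using that by auto
    moreover have "ip H (u i) l = 0" if "i \<in> {1..n}" for i
      using lu[OF that] by (simp add: ip_commute[of H "u i" l])
    ultimately show ?thesis using flag ll lu
      by (auto simp: u'_def tangent_flag_def)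
  qed
  have orth_q: "ip H (q' k) (u' i) = 0" if "i \<in> {1..Suc n}" for i k
  proof -
    have "i \<in> {1..n} \<or> i = Suc n" using that by auto
    then show ?thesis using flag ll lu by (auto simp: ip_q' u'_def tangent_flag_def c_def)
  qed
  have ratio: "(\<lambda>k. a' (Suc j) k / a' j k) \<longlonglongrightarrow> 0" if "j < Suc n" for j
  proof (cases "j = n")
    case True
    have "(\<lambda>k. c (t k) / L2_set (q (t k)) H * (L2_set (q (t k)) H / a n (t k))) \<longlonglongrightarrow> 1 * 0"
      using flag' by (intro tendsto_mult ct) (simp add: tangent_flag_def)
    moreover have "c (t k) / L2_set (q (t k)) H * (L2_set (q (t k)) H / a n (t k)) = c (t k) / a n (t k)" for k
      using ne[of "t k"] by simp
    ultimately show ?thesis by (simp add: True a'_def)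
  next
    case False
    then show ?thesis using flag' that by (simp add: a'_def tangent_flag_def)
  qed
  \<comment> \<open>By Pythagoras the new remainder has squared norm \<open>|q|^2 - c^2\<close>;
    divided by \<open>c^2\<close> this tends to 0 because \<open>c / |q|\<close> tends to 1.\<close>
  have "(\<lambda>k. sqrt ((inverse (c (t k) / L2_set (q (t k)) H))\<^sup>2 - 1)) \<longlonglongrightarrow> sqrt ((inverse 1)\<^sup>2 - 1)"
    by (intro tendsto_intros ct) simp
  moreover have "sqrt ((inverse (c (t k) / L2_set (q (t k)) H))\<^sup>2 - 1) = L2_set (q' k) H / c (t k)" for k
  proof -
    have "ip H (q' k) (q' k) = ip H (q' k) (q (t k)) - c (t k) * ip H (q' k) l"
      unfolding ip_q'[of k "q' k"] ip_commute[of H "q (t k)" "q' k"] ip_commute[of H l "q' k"] ..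
    also have "ip H (q' k) l = 0" by (simp add: ip_q' ll c_def)
    also have "ip H (q' k) (q (t k)) = (L2_set (q (t k)) H)\<^sup>2 - (c (t k))\<^sup>2"
      by (simp add: ip_q' ip_L2 c_def ip_commute[of H l "q (t k)"] power2_eq_square)
    finally have "(L2_set (q' k) H)\<^sup>2 = (L2_set (q (t k)) H)\<^sup>2 - (c (t k))\<^sup>2"
      by (simp add: ip_L2)
    then have "(inverse (c (t k) / L2_set (q (t k)) H))\<^sup>2 - 1 = (L2_set (q' k) H / c (t k))\<^sup>2"
      using c_pos[of k] by (simp add: field_simps)
    then show ?thesis using c_pos[of k] by (simp add: L2_set_nonneg)
  qed
  ultimately have "(\<lambda>k. L2_set (q' k) H / a' (Suc n) k) \<longlonglongrightarrow> 0"
    by (simp add: a'_def)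
  moreover have "p (r (t k)) x = (\<Sum>j\<le>Suc n. a' j k * u' j x) + q' k x" if "x \<in> H" for k x
  proof -
    have "(\<Sum>j\<le>n. a' j k * u' j x) = (\<Sum>j\<le>n. a j (t k) * u j x)"
      by (intro sum.cong) (auto simp: a'_def u'_def)
    then show ?thesis using flag' that by (simp add: a'_def u'_def q'_def tangent_flag_def)
  qed
  moreover have "a' j k > 0" if "j \<le> Suc n" for j k
    using that c_pos flag by (auto simp: a'_def tangent_flag_def le_Suc_eq)
  moreover have "a' 0 k = 1" for k using flag by (simp add: a'_def tangent_flag_def)
  moreover have "strict_mono (\<lambda>k. r (t k))" using flag' by (simp add: tangent_flag_def)
  ultimately have "tangent_flag H p (Suc n) u' a' (\<lambda>k. r (t k)) q'"
    using orth orth_q ratio unfolding tangent_flag_def by blast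
  then show ?thesis by blast
qed

text \<open>If the remainder vanishes infinitely often, those indices give an exact flag. Otherwise
  it is nonzero from some index on and the flag can be prolonged, but there are at most
  \<open>card H\<close> orthonormal directions.\<close>

lemma ex_tangent_flag:
  assumes "finite H" and "\<And>k x. x \<in> H \<Longrightarrow> \<bar>p k x\<bar> \<le> B"
  shows "\<exists>n u a r. tangent_flag H p n u a r (\<lambda>_ _. 0)"
proof (rule ccontr)
  assume none: "\<not> ?thesis"
  have "\<exists>u a r q. tangent_flag H p n u a r q" for n
  proof (induction n)
    case 0
    show ?case using assms by (rule tangent_flag_0)
  next
    case (Suc n)
    then obtain u a r q where flag: "tangent_flag H p n u a r q" by blast
    have "finite {k. L2_set (q k) H = 0}"
    proof (rule ccontr)
      assume "infinite {k. L2_set (q k) H = 0}"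
      from infinite_enumerate[OF this] obtain s :: "nat \<Rightarrow> nat"
        where s: "strict_mono s" "\<forall>k. s k \<in> {k. L2_set (q k) H = 0}" by (elim exE conjE)
      have "q (s k) x = 0" if "x \<in> H" for k x
        using s(2) that assms(1) by (simp add: L2_set_eq_0_iff)
      then have "tangent_flag H p n u (\<lambda>j k. a j (s k)) (\<lambda>k. r (s k)) (\<lambda>_ _. 0)"
        using tangent_flag_subseq[OF flag s(1)] unfolding tangent_flag_def
        by (simp add: ip_def L2_set_def)
      then show False using none by blast
    qed
    then obtain N where "{k. L2_set (q k) H = 0} \<subseteq> {..<N}"
      using finite_nat_iff_bounded by blast
    then have N: "L2_set (q (k + N)) H > 0" for k
      using L2_set_nonneg[of "q (k + N)" H] by (fastforce simp: less_le)
    have "strict_mono (\<lambda>k. k + N)" by (simp add: strict_mono_def)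
    from tangent_flag_Suc[OF assms(1) tangent_flag_subseq[OF flag this] N] show ?case .
  qed
  then obtain u a r q where "tangent_flag H p (Suc (card H)) u a r q" by blast
  then have "card {1..Suc (card H)} \<le> card H"
    by (intro orthonormal_card_le[OF assms(1), of _ u]) (auto simp: tangent_flag_def)
  then show False by simp
qed

section \<open>Simplices and soundness\<close>

lemma ratio_tendsto_0:
  fixes b :: "nat \<Rightarrow> nat \<Rightarrow> real"
  assumes pos: "\<And>j k. j \<le> n \<Longrightarrow> b j k > 0"
    and ratio: "\<And>j. j < n \<Longrightarrow> (\<lambda>k. b (Suc j) k / b j k) \<longlonglongrightarrow> 0"
    and "s < j" and "j \<le> n"
  shows "(\<lambda>k. b j k / b s k) \<longlonglongrightarrow> 0"
  using assms(3,4)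
proof (induction j rule: less_Suc_induct)
  case (1 i)
  then show ?case using ratio by simp
next
  case (2 i j k)
  then have "(\<lambda>l. b k l / b j l * (b j l / b i l)) \<longlonglongrightarrow> 0 * 0"
    by (intro tendsto_mult) auto
  moreover have "b j l \<noteq> 0" for l
    using pos[of j l] 2 by simp
  ultimately show ?case by simp
qed

text \<open>After division by \<open>b s k\<close> only the leading term survives in the limit. The
  scale \<open>b\<close> is kept abstract to cover both the coefficients of the sequence and the
  powers \<open>1 / m ^ j\<close> of the simplices.\<close>

lemma lex_sum_pos:
  fixes b :: "nat \<Rightarrow> nat \<Rightarrow> real"
  assumes pos: "\<And>j k. j \<le> n \<Longrightarrow> b j k > 0"
    and ratio: "\<And>j. j < n \<Longrightarrow> (\<lambda>k. b (Suc j) k / b j k) \<longlonglongrightarrow> 0"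
    and "s \<le> n" and zero: "\<And>j. j < s \<Longrightarrow> d j = 0" and "d s > (0 :: real)"
  shows "\<forall>\<^sub>F k in sequentially. (\<Sum>j\<le>n. d j * b j k) > 0"
proof -
  have "(\<lambda>k. d j * b j k / b s k) \<longlonglongrightarrow> (if j = s then d s else 0)" if "j \<le> n" for j
  proof (cases j s rule: linorder_cases)
    case less
    then show ?thesis using zero by simp
  next
    case equal
    have "d s * b s k / b s k = d s" for k using pos[OF \<open>s \<le> n\<close>, of k] by simp
    then show ?thesis using equal by simp
  next
    case greater
    have "(\<lambda>k. b j k / b s k) \<longlonglongrightarrow> 0"
      using pos ratio greater that by (rule ratio_tendsto_0)
    from tendsto_mult_left[OF this, of "d j"] show ?thesis using greater by simp
  qed
  then have "(\<lambda>k. \<Sum>j\<le>n. d j * b j k / b s k) \<longlonglongrightarrow> (\<Sum>j\<le>n. if j = s then d s else 0)"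
    by (intro tendsto_sum) simp
  then have "(\<lambda>k. (\<Sum>j\<le>n. d j * b j k) / b s k) \<longlonglongrightarrow> d s"
    using \<open>s \<le> n\<close> by (simp add: sum_divide_distrib)
  then have "\<forall>\<^sub>F k in sequentially. (\<Sum>j\<le>n. d j * b j k) / b s k > 0"
    using \<open>d s > 0\<close> by (rule order_tendstoD)
  then show ?thesis
  proof (rule eventually_mono)
    fix k assume "(\<Sum>j\<le>n. d j * b j k) / b s k > 0"
    then show "(\<Sum>j\<le>n. d j * b j k) > 0"
      using pos[OF \<open>s \<le> n\<close>, of k] by (auto simp: zero_less_divide_iff)
  qed
qed

lemma lex_power_sum_pos:
  assumes "s \<le> n" and "\<And>j. j < s \<Longrightarrow> d j = 0" and "d s > (0 :: real)"
  shows "\<forall>\<^sub>F m in sequentially. (\<Sum>j\<le>n. d j / real m ^ j) > 0"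
proof -
  \<comment> \<open>The shift avoids \<open>m = 0\<close>, where \<open>1 / real m ^ j\<close> is 0
    for \<open>j > 0\<close> and positivity of the scale fails.\<close>
  have "\<forall>\<^sub>F m in sequentially. (\<Sum>j\<le>n. d j * (1 / real (Suc m) ^ j)) > 0"
  proof (rule lex_sum_pos)
    have "(1 / x ^ Suc j) / (1 / x ^ j) = inverse x" if "x \<noteq> 0" for x :: real and j
      using that by (simp add: field_simps)
    from this[of "real (Suc _)"]
    show "(\<lambda>k. (1 / real (Suc k) ^ Suc j) / (1 / real (Suc k) ^ j)) \<longlonglongrightarrow> 0" for j
      using LIMSEQ_inverse_real_of_nat by simp
  qed (use assms in auto)
  then have "\<forall>\<^sub>F m in sequentially. (\<Sum>j\<le>n. d j / real (Suc m) ^ j) > 0" by simp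
  then show ?thesis by (subst (asm) eventually_sequentially_Suc)
qed

lemma sum_partial_sums_swap:
  fixes c h :: "nat \<Rightarrow> real"
  shows "(\<Sum>i<N. c i * (\<Sum>j\<le>i. h j)) = (\<Sum>j<N. (\<Sum>i\<in>{j..<N}. c i) * h j)"
proof (induction N)
  case (Suc N)
  have "(\<Sum>j<N. (\<Sum>i\<in>{j..<Suc N}. c i) * h j) = (\<Sum>j<N. (\<Sum>i\<in>{j..<N}. c i) * h j) + (\<Sum>j<N. c N * h j)"
    unfolding sum.distrib[symmetric] by (intro sum.cong) (auto simp: algebra_simps)
  then show ?case
    using Suc by (simp add: sum_distrib_left[symmetric] lessThan_Suc_atMost[symmetric] distrib_left)
qed simp

text \<open>
  In the coordinates \<open>b j = c j + \<dots> + c t\<close> the simplex consists of the points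
  \<open>\<Sum>\<^sub>j b j * u\<^sub>j / m ^ j\<close> with \<open>b\<close> decreasing from \<open>b 0 = 1\<close>, and passing from \<open>m'\<close> to \<open>m\<close> multiplies
  \<open>b j\<close> by \<open>(m / m') ^ j\<close>.
\<close>

lemma dv_simplex_antimono:
  assumes "0 < m" and "m \<le> m'"
  shows "dv_simplex H U m' \<subseteq> dv_simplex H U m"
proof
  fix v assume "v \<in> dv_simplex H U m'"
  then obtain c' :: "nat \<Rightarrow> real" where c': "\<And>i. i < length U \<Longrightarrow> c' i \<ge> 0" "(\<Sum>i<length U. c' i) = 1"
    and v: "v = (\<lambda>x\<in>H. \<Sum>i<length U. c' i * dv_vertex H U m' i x)"
    by (auto simp: dv_simplex_def)
  define N where "N = length U"
  define b' where "b' j = (\<Sum>i\<in>{j..<N}. c' i)" for j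
  define q where "q = real m / real m'"
  define b where "b j = b' j * q ^ j" for j
  define c where "c j = b j - b (Suc j)" for j
  have q: "0 \<le> q" "q \<le> 1" using assms by (simp_all add: q_def)
  have b'_nonneg: "b' j \<ge> 0" for j
    unfolding b'_def by (intro sum_nonneg) (use c'(1) in \<open>auto simp: N_def\<close>)
  have c_nonneg: "c j \<ge> 0" if "j < N" for j
  proof -
    have "b' j = c' j + b' (Suc j)" using that by (simp add: b'_def sum.atLeast_Suc_lessThan)
    then have "b' (Suc j) \<le> b' j" using c'(1)[of j] that by (simp add: N_def)
    moreover have "q ^ Suc j \<le> q ^ j" using q by (simp add: mult_left_le_one_le)
    ultimately have "b' (Suc j) * q ^ Suc j \<le> b' j * q ^ j"
      using q b'_nonneg by (intro mult_mono) auto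
    then show ?thesis by (simp add: c_def b_def)
  qed
  have c_sum: "(\<Sum>i\<in>{j..<N}. c i) = b j" if "j \<le> N" for j
  proof -
    have "(\<Sum>i\<in>{j..<N}. c i) = - (\<Sum>i\<in>{j..<N}. b (Suc i) - b i)"
      by (simp add: c_def sum_negf[symmetric])
    also have "\<dots> = b j - b N" using that by (simp add: sum_Suc_diff')
    also have "b N = 0" by (simp add: b_def b'_def)
    finally show ?thesis by simp
  qed
  have "(\<Sum>i<N. c i) = 1"
    using c_sum[of 0] c'(2) by (simp add: atLeast0LessThan b_def b'_def N_def)
  moreover have "v = (\<lambda>x\<in>H. \<Sum>i<N. c i * dv_vertex H U m i x)"
    unfolding v N_def[symmetric]
  proof (rule restrict_ext)
    fix x assume x: "x \<in> H"
    have "(\<Sum>i<N. c i * dv_vertex H U m i x) = (\<Sum>j<N. (\<Sum>i\<in>{j..<N}. c i) * ((U ! j) x / real m ^ j))"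
      using x by (simp add: dv_vertex_def sum_partial_sums_swap)
    also have "\<dots> = (\<Sum>j<N. b' j * ((U ! j) x / real m' ^ j))"
      using assms by (intro sum.cong) (auto simp: c_sum b_def q_def power_divide field_simps)
    also have "\<dots> = (\<Sum>i<N. c' i * dv_vertex H U m' i x)"
      using x by (simp add: dv_vertex_def sum_partial_sums_swap b'_def)
    finally show "(\<Sum>i<N. c' i * dv_vertex H U m' i x) = (\<Sum>i<N. c i * dv_vertex H U m i x)" ..
  qed
  ultimately show "v \<in> dv_simplex H U m"
    using c_nonneg by (auto simp: dv_simplex_def N_def)
qed

section \<open>Truth on simplices and soundness\<close>

lemma luk_eval_range:
  assumes "v \<in> cube H" and "vars \<phi> \<subseteq> H"
  shows "luk_eval v \<phi> \<in> {0..1}"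
  using assms(2)
proof (induction \<phi>)
  case (Var x)
  then show ?case using assms(1) by (auto simp: cube_def PiE_iff)
qed (auto simp: mv_neg_def mv_oplus_def)

lemma luk_axiom_eval:
  assumes "luk_axiom \<phi>" and "vars \<phi> \<subseteq> H" and "v \<in> cube H"
  shows "luk_eval v \<phi> = 1"
  using assms(1,2)
proof cases
  case (A1 a b)
  then show ?thesis using assms(2) luk_eval_range[OF assms(3), of a] luk_eval_range[OF assms(3), of b]
    by (auto simp: mv_neg_def mv_oplus_def)
next
  case (A2 a b c)
  then show ?thesis using assms(2) luk_eval_range[OF assms(3), of a] luk_eval_range[OF assms(3), of b]
      luk_eval_range[OF assms(3), of c]
    by (auto simp: mv_neg_def mv_oplus_def)
next
  case (A3 a b)
  then show ?thesis using assms(2) luk_eval_range[OF assms(3), of a] luk_eval_range[OF assms(3), of b]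
    by (auto simp: mv_neg_def mv_oplus_def)
next
  case (A4 a b)
  then show ?thesis using assms(2) luk_eval_range[OF assms(3), of a] luk_eval_range[OF assms(3), of b]
    by (auto simp: mv_neg_def mv_oplus_def)
qed

lemma McN_embed_truth_fun:
  assumes "vars \<phi> \<subseteq> H" and "H \<subseteq> K"
  shows "McN_embed H K (truth_fun H \<phi>) = truth_fun K \<phi>"
proof -
  have "restrict v H \<in> cube H" if "v \<in> cube K" for v
    using that assms(2) by (auto simp: cube_def PiE_iff)
  moreover have "luk_eval (restrict v H) \<phi> = luk_eval v \<phi>" for v
    using assms(1) by (intro luk_eval_cong) auto
  ultimately show ?thesis
    unfolding McN_embed_def truth_fun_def by (auto intro!: restrict_ext)
qed

text \<open>This is injectivity of the embedding: a point of the small cube extends to the large one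
  by the value 0.\<close>

lemma truth_fun_eq_of_superset:
  assumes "vars \<phi> \<subseteq> H" and "vars \<psi> \<subseteq> H" and "H \<subseteq> K" and "truth_fun K \<phi> = truth_fun K \<psi>"
  shows "truth_fun H \<phi> = truth_fun H \<psi>"
  unfolding truth_fun_def
proof (rule restrict_ext)
  fix v assume v: "v \<in> cube H"
  define v' where "v' = (\<lambda>x\<in>K. if x \<in> H then v x else 0)"
  have v': "v' \<in> cube K" using v by (auto simp: cube_def PiE_iff v'_def)
  have "luk_eval v' \<phi> = luk_eval v \<phi>" "luk_eval v' \<psi> = luk_eval v \<psi>"
    using assms(1-3) by (auto intro!: luk_eval_cong simp: v'_def)
  moreover have "luk_eval v' \<phi> = luk_eval v' \<psi>"
    using fun_cong[OF assms(4), of v'] v' by (simp add: truth_fun_def)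
  ultimately show "luk_eval v \<phi> = luk_eval v \<psi>" by simp
qed

text \<open>From right to left, domination only supplies some member of the small ideal with the
  same image; injectivity of the embedding identifies it with the given truth function.\<close>

lemma dominates_truth_fun:
  assumes "H \<subseteq> K" and "dominates K V H U" and "vars \<phi> \<subseteq> H"
  shows "truth_fun H \<phi> \<in> dv_ideal H U \<longleftrightarrow> truth_fun K \<phi> \<in> dv_ideal K V"
proof -
  have emb: "McN_embed H K ` dv_ideal H U = dv_ideal K V \<inter> McN_embed H K ` McN H"
    using assms(2) by (simp add: dominates_def)
  have \<phi>: "McN_embed H K (truth_fun H \<phi>) = truth_fun K \<phi>"
    using assms by (intro McN_embed_truth_fun)
  show ?thesis
  proof
    assume "truth_fun H \<phi> \<in> dv_ideal H U"
    from imageI[OF this, of "McN_embed H K"] show "truth_fun K \<phi> \<in> dv_ideal K V"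
      unfolding emb \<phi> by simp
  next
    assume "truth_fun K \<phi> \<in> dv_ideal K V"
    moreover have "truth_fun H \<phi> \<in> McN H" using assms(3) by (auto simp: McN_def)
    from imageI[OF this, of "McN_embed H K"] have "truth_fun K \<phi> \<in> McN_embed H K ` McN H"
      by (simp add: \<phi>)
    ultimately have "truth_fun K \<phi> \<in> McN_embed H K ` dv_ideal H U"
      unfolding emb by simp
    then obtain f where f: "f \<in> dv_ideal H U" "truth_fun K \<phi> = McN_embed H K f" by blast
    then obtain \<psi> where \<psi>: "f = truth_fun H \<psi>" "vars \<psi> \<subseteq> H" by (auto simp: dv_ideal_def McN_def)
    then have "truth_fun K \<phi> = truth_fun K \<psi>" using f McN_embed_truth_fun[OF \<psi>(2) assms(1)] by simp
    then show "truth_fun H \<phi> \<in> dv_ideal H U"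
      using f \<psi> truth_fun_eq_of_superset[OF assms(3) \<psi>(2) assms(1)] by simp
  qed
qed

lemma dominatesI:
  assumes "H \<subseteq> K"
    and "\<And>\<phi>. vars \<phi> \<subseteq> H \<Longrightarrow> truth_fun H \<phi> \<in> dv_ideal H U \<longleftrightarrow> truth_fun K \<phi> \<in> dv_ideal K V"
  shows "dominates K V H U"
proof -
  have "McN_embed H K ` dv_ideal H U \<subseteq> dv_ideal K V \<inter> McN_embed H K ` McN H"
  proof (rule image_subsetI)
    fix f assume f: "f \<in> dv_ideal H U"
    then obtain \<psi> where \<psi>: "f = truth_fun H \<psi>" "vars \<psi> \<subseteq> H" by (auto simp: dv_ideal_def McN_def)
    then have "McN_embed H K f \<in> dv_ideal K V"
      using f assms(2)[OF \<psi>(2)] McN_embed_truth_fun[OF \<psi>(2) assms(1)] by simp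
    then show "McN_embed H K f \<in> dv_ideal K V \<inter> McN_embed H K ` McN H"
      using f by (simp add: dv_ideal_def)
  qed
  moreover have "dv_ideal K V \<inter> McN_embed H K ` McN H \<subseteq> McN_embed H K ` dv_ideal H U"
  proof
    fix g assume g: "g \<in> dv_ideal K V \<inter> McN_embed H K ` McN H"
    then obtain \<psi> where \<psi>: "g = McN_embed H K (truth_fun H \<psi>)" "vars \<psi> \<subseteq> H" by (auto simp: McN_def)
    then have "truth_fun H \<psi> \<in> dv_ideal H U"
      using g assms(2)[OF \<psi>(2)] McN_embed_truth_fun[OF \<psi>(2) assms(1)] by simp
    then show "g \<in> McN_embed H K ` dv_ideal H U" using \<psi>(1) by blast
  qed
  ultimately show ?thesis unfolding dominates_def by (rule equalityI)
qed

lemma truth_fun_in_dv_ideal: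
  assumes "vars \<phi> \<subseteq> H"
  shows "truth_fun H \<phi> \<in> dv_ideal H U \<longleftrightarrow>
    (\<exists>m>0. dv_simplex H U m \<subseteq> cube H \<and> (\<forall>v\<in>dv_simplex H U m. luk_eval v \<phi> = 0))"
proof -
  have "truth_fun H \<phi> \<in> McN H" using assms by (auto simp: McN_def)
  then have "truth_fun H \<phi> \<in> dv_ideal H U \<longleftrightarrow>
      (\<exists>m>0. dv_simplex H U m \<subseteq> cube H \<and> (\<forall>v\<in>dv_simplex H U m. truth_fun H \<phi> v = 0))"
    by (simp add: dv_ideal_def)
  moreover have "(\<forall>v\<in>S. truth_fun H \<phi> v = 0) \<longleftrightarrow> (\<forall>v\<in>S. luk_eval v \<phi> = 0)" if "S \<subseteq> cube H" for S
    using that by (intro ball_cong) (auto simp: truth_fun_def)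
  ultimately show ?thesis by (simp cong: conj_cong)
qed

lemma dv_satisfies_iff: "dv_satisfies W \<phi> \<longleftrightarrow> truth_fun (vars \<phi>) (Neg \<phi>) \<in> dv_ideal (vars \<phi>) (W (vars \<phi>))"
proof -
  have "(\<lambda>v\<in>cube (vars \<phi>). 1 - truth_fun (vars \<phi>) \<phi> v) = truth_fun (vars \<phi>) (Neg \<phi>)"
    unfolding truth_fun_def by (rule restrict_ext) (simp add: mv_neg_def)
  then show ?thesis by (simp add: dv_satisfies_def)
qed

lemma finite_vars: "finite (vars \<phi>)"
  by (induction \<phi>) auto

text \<open>The formulas in one application of Modus Ponens have different variables; domination
  lets all of them be judged on the simplices of a common \<open>K\<close>.\<close>

lemma dv_satisfies_superset:
  assumes W: "is_diff_val_family X W" and "finite K" and "vars \<phi> \<subseteq> K" and "K \<subseteq> X"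
  shows "dv_satisfies W \<phi> \<longleftrightarrow> (\<exists>m>0. dv_simplex K (W K) m \<subseteq> cube K \<and>
    (\<forall>v\<in>dv_simplex K (W K) m. luk_eval v \<phi> = 1))"
proof -
  have "finite (vars \<phi>) \<and> vars \<phi> \<subseteq> X \<and> finite K \<and> K \<subseteq> X"
    using assms finite_vars by auto
  then have "dominates (vars \<phi> \<union> K) (W (vars \<phi> \<union> K)) (vars \<phi>) (W (vars \<phi>))"
    using W unfolding is_diff_val_family_def by blast
  then have "dominates K (W K) (vars \<phi>) (W (vars \<phi>))"
    using assms(3) by (simp add: Un_absorb1)
  then show ?thesis
    unfolding dv_satisfies_iff
    using dominates_truth_fun[OF assms(3), of "W K" "W (vars \<phi>)" "Neg \<phi>"] assms(3)
      truth_fun_in_dv_ideal[of "Neg \<phi>" K "W K"] by (simp add: mv_neg_def)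
qed

lemma dv_satisfies_axiom:
  assumes "is_diff_val_family X W" and "luk_axiom \<phi>" and "vars \<phi> \<subseteq> X"
  shows "dv_satisfies W \<phi>"
proof -
  have "is_diff_val (vars \<phi>) (W (vars \<phi>))"
    using assms(1,3) by (simp add: is_diff_val_family_def finite_vars)
  then have "\<forall>\<^sub>F m in sequentially. dv_simplex (vars \<phi>) (W (vars \<phi>)) m \<subseteq> cube (vars \<phi>)"
    by (simp add: is_diff_val_def)
  then obtain M where M: "\<And>m. m \<ge> M \<Longrightarrow> dv_simplex (vars \<phi>) (W (vars \<phi>)) m \<subseteq> cube (vars \<phi>)"
    by (auto simp: eventually_sequentially)
  have "dv_simplex (vars \<phi>) (W (vars \<phi>)) (Suc M) \<subseteq> cube (vars \<phi>)" by (rule M) simp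
  moreover from this have "\<forall>v\<in>dv_simplex (vars \<phi>) (W (vars \<phi>)) (Suc M). luk_eval v \<phi> = 1"
    using luk_axiom_eval[OF assms(2) order_refl] by blast
  ultimately show ?thesis
    using dv_satisfies_superset[OF assms(1) finite_vars order_refl assms(3)] by blast
qed

lemma dv_satisfies_mp:
  assumes W: "is_diff_val_family X W" and "vars (Imp \<phi> \<psi>) \<subseteq> X"
    and "dv_satisfies W \<phi>" and "dv_satisfies W (Imp \<phi> \<psi>)"
  shows "dv_satisfies W \<psi>"
proof -
  define K where "K = vars (Imp \<phi> \<psi>)"
  define S where "S = dv_simplex K (W K)"
  have K: "finite K" "vars \<phi> \<subseteq> K" "vars \<psi> \<subseteq> K" "vars (Imp \<phi> \<psi>) \<subseteq> K" "K \<subseteq> X"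
    unfolding K_def using assms(2) finite_vars by auto
  note sat = dv_satisfies_superset[OF W K(1) _ K(5), folded S_def]
  obtain m where m: "m > 0" "S m \<subseteq> cube K" "\<And>v. v \<in> S m \<Longrightarrow> luk_eval v \<phi> = 1"
    using assms(3) sat[OF K(2)] by blast
  obtain m' where m': "m' > 0" "\<And>v. v \<in> S m' \<Longrightarrow> luk_eval v (Imp \<phi> \<psi>) = 1"
    using assms(4) sat[OF K(4)] by blast
  \<comment> \<open>The larger index gives a simplex contained in both.\<close>
  define M where "M = max m m'"
  have sub: "S M \<subseteq> S m" "S M \<subseteq> S m'"
    unfolding S_def M_def using m(1) m'(1) by (simp_all add: dv_simplex_antimono)
  have "luk_eval v \<psi> = 1" if v: "v \<in> S M" for v
  proof -
    have "luk_eval v \<phi> = 1" "luk_eval v (Imp \<phi> \<psi>) = 1" using v sub m(3) m'(2) by auto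
    moreover have "luk_eval v \<psi> \<in> {0..1}" using v sub(1) m(2) K(3) luk_eval_range by blast
    ultimately show ?thesis by (auto simp: mv_neg_def mv_oplus_def)
  qed
  moreover have "M > 0" "S M \<subseteq> cube K" using m sub by (auto simp: M_def)
  ultimately show ?thesis using sat[OF K(3)] by blast
qed

lemma luk_derives_FORM:
  assumes "luk_derives X \<Theta> \<phi>" and "\<Theta> \<subseteq> FORM X"
  shows "\<phi> \<in> FORM X"
  using assms by (induction rule: luk_derives.induct) (auto simp: FORM_def)

lemma soundness:
  assumes "luk_derives X \<Theta> \<psi>" and "\<Theta> \<subseteq> FORM X"
  shows "dv_entails X \<Theta> \<psi>"
  unfolding dv_entails_def
proof (intro allI impI)
  fix W assume W: "is_diff_val_family X W" and \<Theta>: "\<forall>\<theta>\<in>\<Theta>. dv_satisfies W \<theta>"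
  show "dv_satisfies W \<psi>"
    using assms(1)
  proof (induction rule: luk_derives.induct)
    case (hyp \<theta>)
    then show ?case using \<Theta> by simp
  next
    case (ax \<phi>)
    then show ?case using dv_satisfies_axiom[OF W] by (simp add: FORM_def)
  next
    case (mp \<phi> \<psi>)
    have "vars (Imp \<phi> \<psi>) \<subseteq> X"
      using luk_derives_FORM[OF mp.hyps(2) assms(2)] by (simp add: FORM_def)
    then show ?case using dv_satisfies_mp[OF W] mp.IH by blast
  qed
qed

section \<open>Differential valuations of prime theories\<close>

definition aff :: "'x set \<Rightarrow> real \<Rightarrow> ('x \<Rightarrow> real) \<Rightarrow> ('x \<Rightarrow> real) \<Rightarrow> real" where
  "aff H c0 c v = c0 + (\<Sum>x\<in>H. c x * v x)"

lemma aff_minus: "aff H (- c0) (\<lambda>x. - c x) v = - aff H c0 c v"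
  by (simp add: aff_def sum_negf)

lemma aff_diff: "aff H (c0 - d0) (\<lambda>x. c x - d x) v = aff H c0 c v - aff H d0 d v"
  by (simp add: aff_def left_diff_distrib sum_subtractf)

lemma aff_const: "aff H c0 (\<lambda>x. 0) v = c0"
  by (simp add: aff_def)

lemma aff_coordinate: "finite H \<Longrightarrow> y \<in> H \<Longrightarrow> aff H 0 (\<lambda>x. if x = y then 1 else 0) v = v y"
  by (simp add: aff_def if_distrib[of "\<lambda>t. t * _"] cong: if_cong)

locale tangent_sequence =
  fixes H :: "'x set" and p :: "nat \<Rightarrow> 'x \<Rightarrow> real" and n :: nat and u :: "nat \<Rightarrow> 'x \<Rightarrow> real"
    and a :: "nat \<Rightarrow> nat \<Rightarrow> real" and r :: "nat \<Rightarrow> nat"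
  assumes finite_H: "finite H" and p_cube: "p k \<in> cube H"
    and flag: "tangent_flag H p n u a r (\<lambda>_ _. 0)"
begin

definition U :: "('x \<Rightarrow> real) list" where "U = map (\<lambda>j. restrict (u j) H) [0..<Suc n]"

lemma length_U: "length U = Suc n"
  by (simp add: U_def)

lemma nth_U: "j \<le> n \<Longrightarrow> U ! j = restrict (u j) H"
  unfolding U_def by (subst nth_map) (auto simp del: upt_Suc)

text \<open>The values of an affine function at \<open>u\<^sub>0\<close> and of its linear part at \<open>u\<^sub>1, \<dots>, u\<^sub>n\<close>.\<close>

definition lam :: "real \<Rightarrow> ('x \<Rightarrow> real) \<Rightarrow> nat \<Rightarrow> real" where
  "lam c0 c j = (if j = 0 then c0 else 0) + (\<Sum>x\<in>H. c x * u j x)"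

text \<open>The condition \<open>t 0 = 1\<close> lets the constant term be absorbed into the
  coefficient at \<open>u\<^sub>0\<close>. Simplex vertices and points of the sequence both have
  this form.\<close>

lemma aff_expansion:
  assumes "\<And>x. x \<in> H \<Longrightarrow> v x = (\<Sum>j\<le>i. t j * u j x)" and "t 0 = 1"
  shows "aff H c0 c v = (\<Sum>j\<le>i. lam c0 c j * t j)"
proof -
  have "(\<Sum>x\<in>H. c x * v x) = (\<Sum>x\<in>H. \<Sum>j\<le>i. c x * u j x * t j)"
    by (intro sum.cong) (auto simp: assms(1) sum_distrib_left mult_ac)
  also have "\<dots> = (\<Sum>j\<le>i. (\<Sum>x\<in>H. c x * u j x) * t j)"
    by (subst sum.swap) (simp add: sum_distrib_right)
  finally have "(\<Sum>x\<in>H. c x * v x) = (\<Sum>j\<le>i. (\<Sum>x\<in>H. c x * u j x) * t j)" .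
  moreover have "c0 = (\<Sum>j\<le>i. (if j = 0 then c0 else 0) * t j)"
    using assms(2) by (simp add: if_distrib[of "\<lambda>s. s * _"] cong: if_cong)
  ultimately show ?thesis
    by (simp add: aff_def lam_def distrib_right sum.distrib)
qed

lemma aff_vertex:
  assumes "i \<le> n"
  shows "aff H c0 c (dv_vertex H U m i) = (\<Sum>j\<le>i. lam c0 c j / real m ^ j)"
proof -
  have "dv_vertex H U m i x = (\<Sum>j\<le>i. 1 / real m ^ j * u j x)" if "x \<in> H" for x
    using that assms by (auto simp: dv_vertex_def nth_U intro!: sum.cong)
  from aff_expansion[of "dv_vertex H U m i" "\<lambda>j. 1 / real m ^ j" i, OF this] show ?thesis by simp
qed

lemma aff_sequence: "aff H c0 c (p (r k)) = (\<Sum>j\<le>n. lam c0 c j * a j k)"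
  using flag by (intro aff_expansion) (auto simp: tangent_flag_def)

lemma aff_simplex:
  assumes "v \<in> dv_simplex H U m"
  obtains w where "\<And>i. i \<le> n \<Longrightarrow> w i \<ge> 0" and "sum w {..n} = 1"
    and "\<And>c0 c. aff H c0 c v = (\<Sum>i\<le>n. w i * (\<Sum>j\<le>i. lam c0 c j / real m ^ j))"
proof -
  from assms obtain w :: "nat \<Rightarrow> real" where
    w: "\<forall>i<Suc n. w i \<ge> 0" "sum w {..<Suc n} = 1"
    and v: "v = (\<lambda>x\<in>H. \<Sum>i<Suc n. w i * dv_vertex H U m i x)"
    unfolding dv_simplex_def length_U by blast
  have "aff H c0 c v = (\<Sum>i\<le>n. w i * (\<Sum>j\<le>i. lam c0 c j / real m ^ j))" for c0 c
  proof -
    have "(\<Sum>x\<in>H. c x * v x) = (\<Sum>x\<in>H. \<Sum>i\<le>n. w i * (c x * dv_vertex H U m i x))"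
      by (intro sum.cong) (auto simp: v lessThan_Suc_atMost sum_distrib_left mult_ac)
    also have "\<dots> = (\<Sum>i\<le>n. w i * (\<Sum>x\<in>H. c x * dv_vertex H U m i x))"
      by (subst sum.swap) (simp add: sum_distrib_left)
    finally have "aff H c0 c v = (\<Sum>i\<le>n. w i) * c0 + (\<Sum>i\<le>n. w i * (\<Sum>x\<in>H. c x * dv_vertex H U m i x))"
      using w(2) by (simp add: aff_def lessThan_Suc_atMost)
    also have "\<dots> = (\<Sum>i\<le>n. w i * aff H c0 c (dv_vertex H U m i))"
      by (simp add: aff_def distrib_left sum.distrib sum_distrib_right)
    also have "\<dots> = (\<Sum>i\<le>n. w i * (\<Sum>j\<le>i. lam c0 c j / real m ^ j))"
      by (intro sum.cong) (auto simp: aff_vertex)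
    finally show ?thesis .
  qed
  with w show thesis by (intro that[of w]) (auto simp: lessThan_Suc_atMost)
qed

text \<open>The last vertex involves all directions, so it witnesses strict positivity wherever the
  leading coefficient sits.\<close>

lemma last_vertex_in_simplex: "dv_vertex H U m n \<in> dv_simplex H U m"
proof -
  have "dv_vertex H U m n = (\<lambda>x\<in>H. \<Sum>i<length U. (if i = n then 1 else 0) * dv_vertex H U m i x)"
    by (auto simp: length_U if_distrib[of "\<lambda>t. t * _"] dv_vertex_def restrict_def cong: if_cong)
  then show ?thesis
    unfolding dv_simplex_def
    by (intro CollectI exI[of _ "\<lambda>i. if i = n then 1 else 0"]) (auto simp: length_U)
qed

definition vanishing where
  "vanishing c0 c \<longleftrightarrow> (\<forall>m. \<forall>v\<in>dv_simplex H U m. aff H c0 c v = 0) \<and> (\<forall>k. aff H c0 c (p (r k)) = 0)"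

text \<open>An affine function with positive leading coefficient may vanish on a face of the
  simplex, for instance at \<open>u\<^sub>0\<close>; so strictness is asked only somewhere on the
  simplex, but at every late point of the sequence.\<close>

definition positive where
  "positive c0 c \<longleftrightarrow> (\<forall>\<^sub>F m in sequentially. \<forall>v\<in>dv_simplex H U m. aff H c0 c v \<ge> 0) \<and>
     (\<forall>\<^sub>F m in sequentially. \<exists>v\<in>dv_simplex H U m. aff H c0 c v > 0) \<and>
     (\<forall>\<^sub>F k in sequentially. aff H c0 c (p (r k)) > 0)"

lemma positiveI:
  assumes "s \<le> n" and "\<And>j. j < s \<Longrightarrow> lam c0 c j = 0" and "lam c0 c s > 0"
  shows "positive c0 c"
proof -
  have "\<forall>\<^sub>F m in sequentially. (\<Sum>j\<le>i. lam c0 c j / real m ^ j) \<ge> 0" if "i \<le> n" for i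
  proof (cases "s \<le> i")
    case True
    from lex_power_sum_pos[OF this, of "lam c0 c"] assms show ?thesis
      by (auto elim: eventually_mono)
  next
    case False
    then show ?thesis using assms(2) by simp
  qed
  then have "\<forall>\<^sub>F m in sequentially. \<forall>i\<in>{..n}. (\<Sum>j\<le>i. lam c0 c j / real m ^ j) \<ge> 0"
    by (intro eventually_ball_finite) auto
  then have "\<forall>\<^sub>F m in sequentially. \<forall>v\<in>dv_simplex H U m. aff H c0 c v \<ge> 0"
  proof (rule eventually_mono, intro ballI)
    fix m v assume *: "\<forall>i\<in>{..n}. (\<Sum>j\<le>i. lam c0 c j / real m ^ j) \<ge> 0" and v: "v \<in> dv_simplex H U m"
    from v obtain w where w: "\<And>i. i \<le> n \<Longrightarrow> w i \<ge> 0"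
      and eq: "aff H c0 c v = (\<Sum>i\<le>n. w i * (\<Sum>j\<le>i. lam c0 c j / real m ^ j))"
      by (rule aff_simplex) blast
    show "aff H c0 c v \<ge> 0"
      unfolding eq by (rule sum_nonneg, rule mult_nonneg_nonneg) (use * w in auto)
  qed
  moreover have "\<forall>\<^sub>F m in sequentially. (\<Sum>j\<le>n. lam c0 c j / real m ^ j) > 0"
    using assms by (rule lex_power_sum_pos)
  then have "\<forall>\<^sub>F m in sequentially. \<exists>v\<in>dv_simplex H U m. aff H c0 c v > 0"
  proof (rule eventually_mono)
    fix m assume "(\<Sum>j\<le>n. lam c0 c j / real m ^ j) > 0"
    then have "aff H c0 c (dv_vertex H U m n) > 0" by (simp add: aff_vertex)
    then show "\<exists>v\<in>dv_simplex H U m. aff H c0 c v > 0"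
      using last_vertex_in_simplex[of m] by blast
  qed
  moreover have "\<forall>\<^sub>F k in sequentially. (\<Sum>j\<le>n. lam c0 c j * a j k) > 0"
    by (rule lex_sum_pos[of n a s]) (use flag assms in \<open>auto simp: tangent_flag_def\<close>)
  ultimately show ?thesis by (simp add: positive_def aff_sequence)
qed

text \<open>The first nonzero coefficient among \<open>lam c0 c 0, \<dots>, lam c0 c n\<close>
  decides the sign on both sides.\<close>

lemma affine_trichotomy: "vanishing c0 c \<or> positive c0 c \<or> positive (- c0) (\<lambda>x. - c x)"
proof (cases "\<forall>j\<le>n. lam c0 c j = 0")
  case True
  have "aff H c0 c v = 0" if "v \<in> dv_simplex H U m" for m v
  proof -
    from that obtain w where "aff H c0 c v = (\<Sum>i\<le>n. w i * (\<Sum>j\<le>i. lam c0 c j / real m ^ j))"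
      by (rule aff_simplex) blast
    then show ?thesis using True by simp
  qed
  then have "vanishing c0 c" using True by (simp add: vanishing_def aff_sequence)
  then show ?thesis by blast
next
  case False
  define s where "s = (LEAST j. lam c0 c j \<noteq> 0)"
  from False obtain j where j: "j \<le> n" "lam c0 c j \<noteq> 0" by blast
  have s: "lam c0 c s \<noteq> 0" unfolding s_def using j(2) by (rule LeastI)
  have "s \<le> n" using Least_le[of "\<lambda>j. lam c0 c j \<noteq> 0" j] j by (simp add: s_def)
  moreover have less: "lam c0 c i = 0" if "i < s" for i
    using not_less_Least[of i "\<lambda>j. lam c0 c j \<noteq> 0"] that by (simp add: s_def)
  moreover have "lam (- c0) (\<lambda>x. - c x) i = - lam c0 c i" for i
    by (simp add: lam_def sum_negf)
  ultimately show ?thesis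
    using s positiveI[of s c0 c] positiveI[of s "- c0" "\<lambda>x. - c x"] by (cases "lam c0 c s > 0") auto
qed

lemma luk_eval_affine:
  assumes "vars \<phi> \<subseteq> H"
  shows "\<exists>c0 c. (\<forall>\<^sub>F m in sequentially. \<forall>v\<in>dv_simplex H U m. luk_eval v \<phi> = aff H c0 c v) \<and>
    (\<forall>\<^sub>F k in sequentially. luk_eval (p (r k)) \<phi> = aff H c0 c (p (r k)))"
  using assms
proof (induction \<phi>)
  case (Var y)
  then have "luk_eval v (Var y) = aff H 0 (\<lambda>x. if x = y then 1 else 0) v" for v
    by (simp add: aff_coordinate finite_H)
  then show ?case by (intro exI[of _ 0] exI[of _ "\<lambda>x. if x = y then 1 else 0"]) simp
next
  case (Neg \<phi>)
  then obtain c0 c where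
    1: "\<forall>\<^sub>F m in sequentially. \<forall>v\<in>dv_simplex H U m. luk_eval v \<phi> = aff H c0 c v" and
    2: "\<forall>\<^sub>F k in sequentially. luk_eval (p (r k)) \<phi> = aff H c0 c (p (r k))" by auto
  \<comment> \<open>The form \<open>0 - c x\<close> lets \<open>aff_diff\<close> subtract from the
    constant function 1.\<close>
  define e where "e = (\<lambda>x. 0 - c x)"
  have *: "aff H (1 - c0) e v = 1 - aff H c0 c v" for v
    unfolding e_def aff_diff aff_const ..
  have "\<forall>\<^sub>F m in sequentially. \<forall>v\<in>dv_simplex H U m. luk_eval v (Neg \<phi>) = aff H (1 - c0) e v"
    using 1 by (rule eventually_mono) (simp add: mv_neg_def *)
  moreover have "\<forall>\<^sub>F k in sequentially. luk_eval (p (r k)) (Neg \<phi>) = aff H (1 - c0) e (p (r k))"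
    using 2 by (rule eventually_mono) (simp add: mv_neg_def *)
  ultimately show ?case by blast
next
  case (Imp \<phi> \<psi>)
  then obtain c0 c d0 d where
    \<phi>: "\<forall>\<^sub>F m in sequentially. \<forall>v\<in>dv_simplex H U m. luk_eval v \<phi> = aff H c0 c v"
       "\<forall>\<^sub>F k in sequentially. luk_eval (p (r k)) \<phi> = aff H c0 c (p (r k))" and
    \<psi>: "\<forall>\<^sub>F m in sequentially. \<forall>v\<in>dv_simplex H U m. luk_eval v \<psi> = aff H d0 d v"
       "\<forall>\<^sub>F k in sequentially. luk_eval (p (r k)) \<psi> = aff H d0 d (p (r k))" by auto
  define e where "e = (\<lambda>x. d x - c x)"
  have diff: "aff H (d0 - c0) e v = aff H d0 d v - aff H c0 c v" for v
    unfolding e_def by (rule aff_diff)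
  \<comment> \<open>The sign of the difference selects the branch of
    \<open>min 1 (1 - x + y)\<close>, the same one on small simplices and at late points.\<close>
  consider "vanishing (d0 - c0) e \<or> positive (d0 - c0) e" | "positive (- (d0 - c0)) (\<lambda>x. - e x)"
    using affine_trichotomy by blast
  then show ?case
  proof cases
    case 1
    then have "\<forall>\<^sub>F m in sequentially. \<forall>v\<in>dv_simplex H U m. aff H c0 c v \<le> aff H d0 d v"
      by (auto simp: vanishing_def positive_def diff)
    with \<phi>(1) \<psi>(1) have "\<forall>\<^sub>F m in sequentially. \<forall>v\<in>dv_simplex H U m.
        luk_eval v (Imp \<phi> \<psi>) = aff H 1 (\<lambda>x. 0) v"
      by eventually_elim (simp add: aff_const mv_neg_def mv_oplus_def)
    moreover from 1 have "\<forall>\<^sub>F k in sequentially. 0 \<le> aff H (d0 - c0) e (p (r k))"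
    proof
      assume "positive (d0 - c0) e"
      then have "\<forall>\<^sub>F k in sequentially. 0 < aff H (d0 - c0) e (p (r k))" by (simp add: positive_def)
      then show ?thesis by (rule eventually_mono) simp
    qed (simp add: vanishing_def)
    with \<phi>(2) \<psi>(2) have "\<forall>\<^sub>F k in sequentially.
        luk_eval (p (r k)) (Imp \<phi> \<psi>) = aff H 1 (\<lambda>x. 0) (p (r k))"
      by eventually_elim (simp add: diff aff_const mv_neg_def mv_oplus_def)
    ultimately show ?thesis by blast
  next
    case 2
    define f where "f = (\<lambda>x. 0 - (c x - d x))"
    have f: "aff H (1 - (c0 - d0)) f v = 1 - (aff H c0 c v - aff H d0 d v)" for v
      unfolding f_def aff_diff aff_const ..
    from 2 have "\<forall>\<^sub>F m in sequentially. \<forall>v\<in>dv_simplex H U m. aff H d0 d v \<le> aff H c0 c v"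
      unfolding positive_def aff_minus diff by simp
    with \<phi>(1) \<psi>(1) have "\<forall>\<^sub>F m in sequentially. \<forall>v\<in>dv_simplex H U m.
        luk_eval v (Imp \<phi> \<psi>) = aff H (1 - (c0 - d0)) f v"
      by eventually_elim (simp add: f mv_neg_def mv_oplus_def)
    moreover from 2 have "\<forall>\<^sub>F k in sequentially. 0 < - aff H (d0 - c0) e (p (r k))"
      unfolding positive_def aff_minus by simp
    with \<phi>(2) \<psi>(2) have "\<forall>\<^sub>F k in sequentially.
        luk_eval (p (r k)) (Imp \<phi> \<psi>) = aff H (1 - (c0 - d0)) f (p (r k))"
      by eventually_elim (simp add: diff f mv_neg_def mv_oplus_def)
    ultimately show ?thesis by blast
  qed
qed

lemma not_positive_minus:
  assumes "\<And>k. aff H c0 c (p k) \<ge> 0"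
  shows "\<not> positive (- c0) (\<lambda>x. - c x)"
proof
  assume "positive (- c0) (\<lambda>x. - c x)"
  then have "\<forall>\<^sub>F k in sequentially. aff H c0 c (p (r k)) < 0"
    by (simp add: positive_def aff_minus)
  then obtain k where "aff H c0 c (p (r k)) < 0"
    using eventually_happens trivial_limit_sequentially by blast
  with assms[of "r k"] show False by simp
qed

text \<open>A negative leading coefficient would show at late points of the sequence. Applied to the
  inequalities defining the cube, this keeps small simplices inside it.\<close>

lemma eventually_aff_nonneg:
  assumes "\<And>k. aff H c0 c (p k) \<ge> 0"
  shows "\<forall>\<^sub>F m in sequentially. \<forall>v\<in>dv_simplex H U m. aff H c0 c v \<ge> 0"
  using affine_trichotomy[of c0 c] not_positive_minus[OF assms]
  by (auto simp: vanishing_def positive_def)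

lemma eventually_simplex_cube: "\<forall>\<^sub>F m in sequentially. dv_simplex H U m \<subseteq> cube H"
proof -
  have "\<forall>\<^sub>F m in sequentially. \<forall>v\<in>dv_simplex H U m. v y \<in> {0..1}" if y: "y \<in> H" for y
  proof -
    let ?c = "\<lambda>x. if x = y then 1 else 0 :: real"
    have c: "aff H 0 ?c v = v y" for v by (rule aff_coordinate[OF finite_H y])
    have d: "aff H (1 - 0) (\<lambda>x. 0 - ?c x) v = 1 - v y" for v
      unfolding aff_diff c aff_const ..
    have p: "0 \<le> p k y" "p k y \<le> 1" for k
      using p_cube[of k] y by (auto simp: cube_def PiE_iff)
    have "\<forall>\<^sub>F m in sequentially. \<forall>v\<in>dv_simplex H U m. 0 \<le> aff H 0 ?c v"
      by (rule eventually_aff_nonneg) (unfold c, rule p)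
    moreover have "\<forall>\<^sub>F m in sequentially. \<forall>v\<in>dv_simplex H U m. 0 \<le> aff H (1 - 0) (\<lambda>x. 0 - ?c x) v"
      by (rule eventually_aff_nonneg) (unfold d, use p in simp)
    ultimately show ?thesis
      unfolding c d by eventually_elim auto
  qed
  then have "\<forall>\<^sub>F m in sequentially. \<forall>y\<in>H. \<forall>v\<in>dv_simplex H U m. v y \<in> {0..1}"
    by (intro eventually_ball_finite finite_H) auto
  then show ?thesis
  proof (rule eventually_mono, intro subsetI)
    fix m v assume "\<forall>y\<in>H. \<forall>v\<in>dv_simplex H U m. v y \<in> {0..1}" and v: "v \<in> dv_simplex H U m"
    moreover from v have "v \<in> extensional H" by (auto simp: dv_simplex_def)
    ultimately show "v \<in> cube H" by (simp add: cube_def PiE_iff)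
  qed
qed

lemma diff_val_U: "is_diff_val H U"
proof -
  have orth: "ip H (u i) (u j) = (if i = j then 1 else 0)" if "i \<in> {1..n}" "j \<in> {1..n}" for i j
    using flag that by (simp add: tangent_flag_def)
  have "(\<Sum>x\<in>H. (U ! i) x * (U ! j) x) = (if i = j then 1 else 0)" if "i \<in> {1..n}" "j \<in> {1..n}" for i j
    using orth[OF that] that by (simp add: nth_U ip_def)
  moreover from this have "L2_set (U ! i) H = 1" if "i \<in> {1..n}" for i
    using that by (simp add: L2_set_def power2_eq_square)
  moreover have "card {1..n} \<le> card H"
    using orth by (intro orthonormal_card_le[OF finite_H, of _ u]) auto
  moreover have "set U \<subseteq> H \<rightarrow>\<^sub>E UNIV"
    by (auto simp: U_def)
  moreover have "{1..<Suc n} = {1..n}" by auto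
  ultimately show ?thesis
    unfolding is_diff_val_def length_U using eventually_simplex_cube length_U by auto
qed

text \<open>The affine function of \<open>\<phi>\<close> either vanishes on all simplices and the
  whole subsequence, or is eventually nonzero somewhere on each simplex and at each point of the
  subsequence. Since the simplices decrease, vanishing on one small simplex is the same as vanishing
  on all late ones.\<close>

lemma truth_fun_ideal_iff:
  assumes "vars \<phi> \<subseteq> H"
  shows "truth_fun H \<phi> \<in> dv_ideal H U \<longleftrightarrow> (\<forall>\<^sub>F k in sequentially. luk_eval (p (r k)) \<phi> = 0)"
proof -
  obtain c0 c where
    simplex: "\<forall>\<^sub>F m in sequentially. \<forall>v\<in>dv_simplex H U m. luk_eval v \<phi> = aff H c0 c v" and
    seq: "\<forall>\<^sub>F k in sequentially. luk_eval (p (r k)) \<phi> = aff H c0 c (p (r k))"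
    using luk_eval_affine[OF assms] by blast
  have ideal_iff: "truth_fun H \<phi> \<in> dv_ideal H U \<longleftrightarrow>
      (\<forall>\<^sub>F m in sequentially. \<forall>v\<in>dv_simplex H U m. luk_eval v \<phi> = 0)"
  proof
    assume "truth_fun H \<phi> \<in> dv_ideal H U"
    then obtain m where "m > 0" "\<forall>v\<in>dv_simplex H U m. luk_eval v \<phi> = 0"
      using truth_fun_in_dv_ideal[OF assms] by blast
    then have "\<forall>v\<in>dv_simplex H U m'. luk_eval v \<phi> = 0" if "m' \<ge> m" for m'
      using dv_simplex_antimono[of m m' H U] that by blast
    then show "\<forall>\<^sub>F m in sequentially. \<forall>v\<in>dv_simplex H U m. luk_eval v \<phi> = 0"
      unfolding eventually_sequentially by blast
  next
    assume "\<forall>\<^sub>F m in sequentially. \<forall>v\<in>dv_simplex H U m. luk_eval v \<phi> = 0"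
    from eventually_conj[OF eventually_gt_at_top[of 0] eventually_conj[OF eventually_simplex_cube this]]
    have "\<exists>m>0. dv_simplex H U m \<subseteq> cube H \<and> (\<forall>v\<in>dv_simplex H U m. luk_eval v \<phi> = 0)"
      using eventually_happens trivial_limit_sequentially by blast
    then show "truth_fun H \<phi> \<in> dv_ideal H U" using truth_fun_in_dv_ideal[OF assms] by blast
  qed
  consider "vanishing c0 c" | "positive c0 c \<or> positive (- c0) (\<lambda>x. - c x)"
    using affine_trichotomy by blast
  then show ?thesis
  proof cases
    case 1
    then have "\<forall>\<^sub>F m in sequentially. \<forall>v\<in>dv_simplex H U m. luk_eval v \<phi> = 0"
      "\<forall>\<^sub>F k in sequentially. luk_eval (p (r k)) \<phi> = 0"
      using simplex seq by (auto simp: vanishing_def elim: eventually_mono)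
    then show ?thesis by (simp add: ideal_iff)
  next
    case 2
    then have ne: "\<forall>\<^sub>F m in sequentially. \<exists>v\<in>dv_simplex H U m. aff H c0 c v \<noteq> 0"
      "\<forall>\<^sub>F k in sequentially. aff H c0 c (p (r k)) \<noteq> 0"
      unfolding positive_def aff_minus by (elim disjE conjE eventually_mono; force)+
    from simplex ne(1) have nz1: "\<forall>\<^sub>F m in sequentially. \<exists>v\<in>dv_simplex H U m. luk_eval v \<phi> \<noteq> 0"
      by eventually_elim simp
    from seq ne(2) have nz2: "\<forall>\<^sub>F k in sequentially. luk_eval (p (r k)) \<phi> \<noteq> 0"
      by eventually_elim simp
    have "\<not> (\<forall>\<^sub>F m in sequentially. \<forall>v\<in>dv_simplex H U m. luk_eval v \<phi> = 0)"
    proof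
      assume "\<forall>\<^sub>F m in sequentially. \<forall>v\<in>dv_simplex H U m. luk_eval v \<phi> = 0"
      from eventually_conj[OF nz1 this] show False
        by (auto dest!: eventually_happens)
    qed
    moreover have "\<not> (\<forall>\<^sub>F k in sequentially. luk_eval (p (r k)) \<phi> = 0)"
    proof
      assume "\<forall>\<^sub>F k in sequentially. luk_eval (p (r k)) \<phi> = 0"
      from eventually_conj[OF nz2 this] show False
        by (auto dest!: eventually_happens)
    qed
    ultimately show ?thesis by (simp add: ideal_iff)
  qed
qed

end

section \<open>From prime theories to differential valuations: completeness\<close>

lemma (in luk_prime) ex_diff_val:
  assumes "finite H"
  shows "\<exists>U. is_diff_val H U \<and>
    (\<forall>\<phi>. vars \<phi> \<subseteq> H \<longrightarrow> (truth_fun H \<phi> \<in> dv_ideal H U \<longleftrightarrow> Neg \<phi> \<in> T))"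
proof -
  obtain p where p: "\<forall>k. p k \<in> cube H \<and>
      (\<forall>\<phi>. vars \<phi> \<subseteq> H \<longrightarrow> size \<phi> \<le> k \<longrightarrow> (luk_eval (p k) \<phi> = 1 \<longleftrightarrow> \<phi> \<in> T))"
    using ex_valuation_sequence[OF assms] by (elim exE)
  have "\<bar>p k x\<bar> \<le> 1" if "x \<in> H" for k x
    using p that by (auto simp: cube_def PiE_iff abs_le_iff intro: order_trans[of _ 0])
  then obtain n u a r where flag: "tangent_flag H p n u a r (\<lambda>_ _. 0)"
    using ex_tangent_flag[OF assms, of p 1] by blast
  interpret ts: tangent_sequence H p n u a r
    using assms p flag by unfold_locales auto
  have "truth_fun H \<phi> \<in> dv_ideal H ts.U \<longleftrightarrow> Neg \<phi> \<in> T" if "vars \<phi> \<subseteq> H" for \<phi>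
  proof -
    \<comment> \<open>Since \<open>r\<close> does not fall behind the identity,
      \<open>p (r k)\<close> still decides every formula of size up to \<open>k\<close>.\<close>
    have r: "k \<le> r k" for k using flag by (simp add: tangent_flag_def seq_suble)
    have eq: "luk_eval (p (r k)) \<phi> = 0 \<longleftrightarrow> Neg \<phi> \<in> T" if k: "k \<ge> size (Neg \<phi>)" for k
    proof -
      have "size (Neg \<phi>) \<le> r k" "vars (Neg \<phi>) \<subseteq> H"
        using k r[of k] \<open>vars \<phi> \<subseteq> H\<close> by auto
      then have "luk_eval (p (r k)) (Neg \<phi>) = 1 \<longleftrightarrow> Neg \<phi> \<in> T" using p by blast
      then show ?thesis by (simp add: mv_neg_def)
    qed
    have "(\<forall>\<^sub>F k in sequentially. luk_eval (p (r k)) \<phi> = 0) \<longleftrightarrow> (\<forall>\<^sub>F k in sequentially. Neg \<phi> \<in> T)"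
      by (rule eventually_cong[OF eventually_ge_at_top eq])
    then show ?thesis using ts.truth_fun_ideal_iff[OF that] by simp
  qed
  then show ?thesis using ts.diff_val_U by blast
qed

lemma (in luk_prime) ex_diff_val_family:
  "\<exists>W. is_diff_val_family X W \<and> (\<forall>\<phi>. dv_satisfies W \<phi> \<longleftrightarrow> \<phi> \<in> T)"
proof -
  have "\<exists>U. finite H \<longrightarrow> is_diff_val H U \<and>
      (\<forall>\<phi>. vars \<phi> \<subseteq> H \<longrightarrow> (truth_fun H \<phi> \<in> dv_ideal H U \<longleftrightarrow> Neg \<phi> \<in> T))" for H
    using ex_diff_val by blast
  then have "\<exists>W. \<forall>H. finite H \<longrightarrow> is_diff_val H (W H) \<and>
      (\<forall>\<phi>. vars \<phi> \<subseteq> H \<longrightarrow> (truth_fun H \<phi> \<in> dv_ideal H (W H) \<longleftrightarrow> Neg \<phi> \<in> T))"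
    by (intro choice allI)
  then obtain W where W: "\<forall>H. finite H \<longrightarrow> is_diff_val H (W H) \<and>
      (\<forall>\<phi>. vars \<phi> \<subseteq> H \<longrightarrow> (truth_fun H \<phi> \<in> dv_ideal H (W H) \<longleftrightarrow> Neg \<phi> \<in> T))"
    by (elim exE)
  have dom: "dominates K (W K) H (W H)" if "finite K" "H \<subseteq> K" for H K
  proof (rule dominatesI[OF that(2)])
    fix \<phi> assume "vars \<phi> \<subseteq> H"
    moreover have "finite H" using that finite_subset by blast
    ultimately show "truth_fun H \<phi> \<in> dv_ideal H (W H) \<longleftrightarrow> truth_fun K \<phi> \<in> dv_ideal K (W K)"
      using W that by simp
  qed
  have "dv_satisfies W \<phi> \<longleftrightarrow> \<phi> \<in> T" for \<phi>
  proof -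
    \<comment> \<open>Satisfaction puts the truth function of \<open>Neg \<phi>\<close> into the
      ideal, and the ideal collects the formulas whose negation is in \<open>T\<close>; hence the
      double negation.\<close>
    have "dv_satisfies W \<phi> \<longleftrightarrow> Neg (Neg \<phi>) \<in> T"
      using W finite_vars[of \<phi>] by (simp add: dv_satisfies_iff)
    also have "\<dots> \<longleftrightarrow> \<phi> \<in> T" using Neg_Neg[of \<phi>] by (auto simp: eqv_def intro: mp)
    finally show ?thesis .
  qed
  moreover have "is_diff_val_family X W"
    using W dom by (simp add: is_diff_val_family_def)
  ultimately show ?thesis by blast
qed

theorem theorem7p6:
  fixes X :: "'x set" and \<Theta> :: "'x luk_form set" and \<psi> :: "'x luk_form"
  assumes "infinite X" and "\<Theta> \<subseteq> FORM X" and "\<psi> \<in> FORM X"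
  shows "dv_entails X \<Theta> \<psi> \<longleftrightarrow> luk_derives X \<Theta> \<psi>"
proof
  assume "luk_derives X \<Theta> \<psi>"
  then show "dv_entails X \<Theta> \<psi>" using assms(2) by (rule soundness)
next
  assume entails: "dv_entails X \<Theta> \<psi>"
  \<comment> \<open>The prime extension ranges over all variables of the type, so the contradiction
    is sought over \<open>UNIV\<close>; the return to \<open>X\<close> is by renaming
    variables.\<close>
  have "luk_derives UNIV \<Theta> \<psi>"
  proof (rule ccontr)
    assume "\<not> luk_derives UNIV \<Theta> \<psi>"
    then obtain T where T: "luk_theory T" "\<Theta> \<subseteq> T" "\<psi> \<notin> T"
      and linear: "\<forall>a b. Imp a b \<in> T \<or> Imp b a \<in> T"
      using prime_theory_exists by blast
    interpret luk_theory T by (rule T(1))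
    interpret luk_prime T by unfold_locales (use linear T(3) in auto)
    obtain W where "is_diff_val_family X W" "\<And>\<phi>. dv_satisfies W \<phi> \<longleftrightarrow> \<phi> \<in> T"
      using ex_diff_val_family[of X] by auto
    then show False using entails T unfolding dv_entails_def by blast
  qed
  then show "luk_derives X \<Theta> \<psi>"
    by (rule luk_derives_conservative) (use assms in auto)
qed

end
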